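(* Let $k\ge3$ and let $\mathfrak{T}$ be a $k$-uniform supertree on $n$ vertices (with $m=n'-1$ edges, where $n'=\frac{n-1}{k-1}+1$). Suppose that $\mathfrak{T}$ is not (isomorphic to) the hyperstar $\mathcal{S}_{n,k}$. Then $$\rho(\mathcal{A}(\mathfrak{T}))\leq \rho(\mathcal{A}(S^k(1,n'-3))),$$ $$\rho(\mathcal{Q}(\mathfrak{T}))\leq \rho(\mathcal{Q}(S^k(1,n'-3))),$$ $$\rho(\mathcal{Q}^{*}(\mathfrak{T}))\leq \rho(\mathcal{Q}^{*}(S^k(1,n'-3))),$$ and for each one of these three inequalities, equality holds if and only if $\mathfrak{T}\cong S^k(1,n'-3)$.
   Context: Hypergraphs. A $k$-uniform hypergraph $G=(V,E)$ has finite vertex set $V=[n]=\{1,\dots,n\}$ and a set $E$ of $k$-element subsets of $V$ (the edges; no repeated edges). The degree $d_i$ of a vertex $i$ is the number of edges containing $i$. A path of length $q$ is a sequence $v_1,e_1,v_2,\dots,v_q,e_q,v_{q+1}$ with distinct vertices $v_1,\dots,v_{q+1}$, distinct edges $e_1,\dots,e_q$, and $v_r,v_{r+1}\in e_r$ for all $r$. A cycle of length $q>1$ is such a sequence in which $v_1,\dots,v_q$ are distinct, $e_1,\dots,e_q$ are distinct and $v_{q+1}=v_1$. $G$ is connected if any two vertices are joined by a path, acyclic if it has no cycle. A supertree is a connected acyclic hypergraph. The hyperstar $\mathcal{S}_{n,k}$ (with $m=\frac{n-1}{k-1}$ edges) is the $k$-uniform hypergraph whose vertex set has a partition $V=V_0\cup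 V_1\cup\cdots\cup V_m$ with $|V_0|=1$, $|V_1|=\cdots=|V_m|=k-1$ and $E=\{V_0\cup V_i : i\in[m]\}$. For an ordinary graph $G=(V,E)$ and $k\ge3$, the $k$th power $G^k$ is the $k$-uniform hypergraph obtained by adding to each edge $e\in E$ a set of $k-2$ new vertices (all new vertices distinct for distinct edges). For nonnegative integers $a,b$, $S(a,b)$ is the ordinary tree on $a+b+2$ vertices obtained from a single edge by attaching $a$ pendent edges to one of its end vertices and $b$ pendent edges to the other; $S^k(a,b)$ is the $k$th power of $S(a,b)$. (If $\mathfrak{T}$ is not a hyperstar then $n'\ge4$, so $S^k(1,n'-3)$ is defined.) Tensors. For a real order-$k$ dimension-$n$ tensor $\mathcal{T}=(\mathcal{T}_{i_1\cdots i_k})$ and $x\in\mathbb{C}^n$, $\mathcal{T}x\in\mathbb{C}^n$ is defined by $(\mathcal{T}x)_i=\sum_{i_2,\dots,i_k=1}^n\mathcal{T}_{ii_2\cdots i_k}x_{i_2}\cdots x_{i_k}$. A number $\lambda\in\mathbb{C}$ is an eigenvalue of $\mathcal{T}$ with eigenvector $0\ne x\in\mathbb{C}^n$ if $(\mathcal{T}x)_i=\lambda x_i^{k-1}$ for all $i$. The spectral radius $\rho(\mathcal{T})$ is the maximum modulus of an eigenvalue of $\mathcal{T}$. For a $k$-uniform hypergraph $G$: the adjacency tensor $\mathcal{A}(G)$ has entries $a_{i_1\cdots i_k}=\frac1{(k-1)!}$ if $\{i_1,\dots,i_k\}\in E$ and $0$ otherwise; the signless Laplacian tensor is $\mathcal{Q}(G)=\mathcal{D}(G)+\mathcal{A}(G)$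 where $\mathcal{D}(G)$ is the diagonal tensor with $\mathcal{D}_{i\cdots i}=d_i$; the incidence $Q$-tensor $\mathcal{Q}^*(G)$ has $(i_1,\dots,i_k)$-entry equal to the number of edges $e$ with $i_t\in e$ for all $t=1,\dots,k$ (indices may repeat). *)

theory Defs
  imports Complex_Main
begin

section \<open>Uniform hypergraphs and supertrees\<close>

record 'a hypergraph =
  verts :: "'a set"
  edges :: "'a set set"

definition uniform_hypergraph :: "nat \<Rightarrow> 'a hypergraph \<Rightarrow> bool" where
  "uniform_hypergraph k H \<longleftrightarrow>
     finite (verts H) \<and> verts H \<noteq> {} \<and>
     (\<forall>e\<in>edges H. e \<subseteq> verts H \<and> card e = k)"

definition degree :: "'a hypergraph \<Rightarrow> 'a \<Rightarrow> nat" where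
  "degree H i = card {e \<in> edges H. i \<in> e}"

text \<open>A sequence \<open>v\<^sub>1, e\<^sub>1, v\<^sub>2, \<dots>, v\<^sub>q, e\<^sub>q, v\<^sub>q\<^sub>+\<^sub>1\<close> is represented by the list
  \<open>vs\<close> of its \<open>q + 1\<close> vertices and the list \<open>es\<close> of its \<open>q\<close> edges.\<close>

definition hwalk :: "'a hypergraph \<Rightarrow> 'a list \<Rightarrow> 'a set list \<Rightarrow> bool" where
  "hwalk H vs es \<longleftrightarrow>
     length vs = length es + 1 \<and> set vs \<subseteq> verts H \<and> set es \<subseteq> edges H \<and>
     (\<forall>r<length es. vs ! r \<in> es ! r \<and> vs ! (r + 1) \<in> es ! r)"

definition hpath :: "'a hypergraph \<Rightarrow> 'a list \<Rightarrow> 'a set list \<Rightarrow> bool" where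
  "hpath H vs es \<longleftrightarrow> hwalk H vs es \<and> distinct vs \<and> distinct es"

definition hcycle :: "'a hypergraph \<Rightarrow> 'a list \<Rightarrow> 'a set list \<Rightarrow> bool" where
  "hcycle H vs es \<longleftrightarrow>
     hwalk H vs es \<and> length es > 1 \<and>
     distinct (butlast vs) \<and> distinct es \<and> last vs = hd vs"

definition hconnected :: "'a hypergraph \<Rightarrow> bool" where
  "hconnected H \<longleftrightarrow>
     (\<forall>u\<in>verts H. \<forall>v\<in>verts H. \<exists>vs es. hpath H vs es \<and> hd vs = u \<and> last vs = v)"

definition hacyclic :: "'a hypergraph \<Rightarrow> bool" where
  "hacyclic H \<longleftrightarrow> \<not> (\<exists>vs es. hcycle H vs es)"

definition supertree :: "'a hypergraph \<Rightarrow> bool" where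
  "supertree H \<longleftrightarrow> hconnected H \<and> hacyclic H"

definition hypergraph_iso :: "'a hypergraph \<Rightarrow> 'b hypergraph \<Rightarrow> bool" where
  "hypergraph_iso G H \<longleftrightarrow>
     (\<exists>f. bij_betw f (verts G) (verts H) \<and> edges H = (\<lambda>e. f ` e) ` edges G)"


section \<open>Special hypergraphs\<close>

text \<open>The hyperstar on \<open>n\<close> vertices is determined only up to isomorphism, so it is
  a predicate. The sets \<open>P 0, \<dots>, P m\<close> form the partition of the vertex set, which
  forces \<open>n - 1 = m (k - 1)\<close>.\<close>

definition is_hyperstar :: "nat \<Rightarrow> nat \<Rightarrow> 'a hypergraph \<Rightarrow> bool" where
  "is_hyperstar n k H \<longleftrightarrow>
     uniform_hypergraph k H \<and> card (verts H) = n \<and>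
     (\<exists>m (P :: nat \<Rightarrow> 'a set). verts H = (\<Union>i\<in>{0..m}. P i) \<and>
        (\<forall>i\<in>{0..m}. \<forall>j\<in>{0..m}. i \<noteq> j \<longrightarrow> P i \<inter> P j = {}) \<and>
        card (P 0) = 1 \<and> (\<forall>i\<in>{1..m}. card (P i) = k - 1) \<and>
        edges H = {P 0 \<union> P i | i. i \<in> {1..m}})"

text \<open>An ordinary graph is a 2-uniform hypergraph. In its \<open>k\<close>th power, \<open>Inl v\<close> is the
  original vertex \<open>v\<close>, and \<open>Inr (e, j)\<close> for \<open>j < k - 2\<close> are the vertices added to
  the edge \<open>e\<close>.\<close>

definition power_hypergraph ::
    "nat \<Rightarrow> 'a hypergraph \<Rightarrow> ('a + 'a set \<times> nat) hypergraph" where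
  "power_hypergraph k G =
     \<lparr>verts = Inl ` verts G \<union> Inr ` (edges G \<times> {..<k - 2}),
      edges = {Inl ` e \<union> Inr ` ({e} \<times> {..<k - 2}) | e. e \<in> edges G}\<rparr>"

text \<open>The tree \<open>S(a, b)\<close>: the vertices 0 and 1 are the ends of the initial edge.\<close>

definition double_star :: "nat \<Rightarrow> nat \<Rightarrow> nat hypergraph" where
  "double_star a b =
     \<lparr>verts = {..<a + b + 2},
      edges = {{0, 1}} \<union> {{0, i} | i. i \<in> {2..<a + 2}}
                \<union> {{1, i} | i. i \<in> {a + 2..<a + b + 2}}\<rparr>"

definition double_star_power ::
    "nat \<Rightarrow> nat \<Rightarrow> nat \<Rightarrow> (nat + nat set \<times> nat) hypergraph" where
  "double_star_power k a b = power_hypergraph k (double_star a b)"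


section \<open>Tensors and their spectral radius\<close>

text \<open>A real tensor of order \<open>k\<close> whose indices range over the finite set \<open>V\<close> is a
  function on index lists; only lists of length \<open>k\<close> over \<open>V\<close> are relevant.
  Likewise only the values on \<open>V\<close> of a vector \<open>x :: 'a \<Rightarrow> complex\<close> matter.\<close>

type_synonym 'a tensor = "'a list \<Rightarrow> real"

definition tensor_apply ::
    "nat \<Rightarrow> 'a set \<Rightarrow> 'a tensor \<Rightarrow> ('a \<Rightarrow> complex) \<Rightarrow> 'a \<Rightarrow> complex" where
  "tensor_apply k V A x i =
     (\<Sum>js | length js = k - 1 \<and> set js \<subseteq> V.
        complex_of_real (A (i # js)) * prod_list (map x js))"

definition tensor_eigenvalue :: "nat \<Rightarrow> 'a set \<Rightarrow> 'a tensor \<Rightarrow> complex \<Rightarrow> bool" where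
  "tensor_eigenvalue k V A l \<longleftrightarrow>
     (\<exists>x. (\<exists>i\<in>V. x i \<noteq> 0) \<and> (\<forall>i\<in>V. tensor_apply k V A x i = l * x i ^ (k - 1)))"

text \<open>For \<open>k \<ge> 2\<close> and finite nonempty \<open>V\<close> the set of eigenvalues is nonempty and
  finite, so the supremum below is the maximum modulus.\<close>

definition spectral_radius :: "nat \<Rightarrow> 'a set \<Rightarrow> 'a tensor \<Rightarrow> real" where
  "spectral_radius k V A = Sup {cmod l | l. tensor_eigenvalue k V A l}"

definition adjacency_tensor :: "nat \<Rightarrow> 'a hypergraph \<Rightarrow> 'a tensor" where
  "adjacency_tensor k H js = (if set js \<in> edges H then 1 / fact (k - 1) else 0)"

definition degree_tensor :: "nat \<Rightarrow> 'a hypergraph \<Rightarrow> 'a tensor" where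
  "degree_tensor k H js =
     (if js = replicate k (hd js) then real (degree H (hd js)) else 0)"

definition signless_laplacian_tensor :: "nat \<Rightarrow> 'a hypergraph \<Rightarrow> 'a tensor" where
  "signless_laplacian_tensor k H js = degree_tensor k H js + adjacency_tensor k H js"

definition incidence_Q_tensor :: "'a hypergraph \<Rightarrow> 'a tensor" where
  "incidence_Q_tensor H js = real (card {e \<in> edges H. set js \<subseteq> e})"

end

theory Submission
  imports Defs "HOL-Analysis.Function_Topology"
begin

text \<open>
  All three tensors of a hypergraph have the form \<open>\<T>(js) = \<Sum>\<^bsub>e\<^esub> [set js \<subseteq> e] g(card (set js))\<close> with
  a function \<open>g \<ge> 0\<close>, \<open>g(k) > 0\<close>, that depends only on the kind of tensor, so they are treated
  together. Such a tensor is symmetric and nonnegative, and its spectral radius is the maximum of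
  \<open>F(x) / \<Sum>\<^bsub>i\<^esub> x\<^sub>i\<^sup>k\<close> over the nonzero nonnegative vectors, where \<open>F\<close> is the form of the tensor
  (\<open>spectral_radius_rayleigh_max\<close>). Every maximiser solves the eigenvalue equation
  (\<open>rayleigh_max_eigen\<close>), and it is positive when the hypergraph is connected
  (\<open>rayleigh_max_pos\<close>).

  Let \<open>x\<close> be a maximiser for the supertree \<open>T\<close>, and root \<open>T\<close> at a vertex \<open>u\<close> where \<open>x\<close> is largest.
  Each edge \<open>e\<close> has a vertex \<open>p e\<close> nearest to \<open>u\<close>, and the sets \<open>e - {p e}\<close> partition the vertices
  other than \<open>u\<close> (\<open>supertree_rooted\<close>). As \<open>T\<close> is not a hyperstar, some edge \<open>f\<close> avoids \<open>u\<close>. Keep \<open>f\<close>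
  and replace, in every other edge \<open>e\<close>, the vertex \<open>p e\<close> by \<open>u\<close>. The resulting hypergraph consists of
  edges through \<open>u\<close> that are otherwise disjoint, together with \<open>f\<close>, which is attached to one of them
  at \<open>p f\<close>; it is therefore isomorphic to \<open>S\<^sup>k(1, n' - 3)\<close> (\<open>move_edges_broom\<close>, \<open>broom_iso\<close>). Since
  \<open>x\<close> is largest at \<open>u\<close>, no term of \<open>F(x)\<close> has become smaller, so the spectral radius has not
  decreased. If it has stayed the same, then \<open>x\<close> is a maximiser for the new hypergraph as well.
  Comparing the two eigenvalue equations at \<open>u\<close> then shows, as \<open>x\<close> is positive, that no edge was
  moved (\<open>rayleigh_max_move_edges\<close>), so \<open>T\<close> itself is isomorphic to \<open>S\<^sup>k(1, n' - 3)\<close>. The converse is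
  the invariance of the spectral radius under isomorphism (\<open>rayleigh_max_iso\<close>).
\<close>

section \<open>Polarised forms\<close>

text \<open>\<open>pform V c m x a\<close> is the sum of \<open>c (a \<union> {i\<^sub>1, \<dots>, i\<^sub>m}) x i\<^sub>1 \<dots> x i\<^sub>m\<close> over all
  sequences \<open>i\<^sub>1, \<dots>, i\<^sub>m\<close> in \<open>V\<close>. If the entry of an order-\<open>k\<close> tensor \<open>A\<close> at each sequence
  depends, through \<open>c\<close>, only on the set of its indices, then \<open>pform V c k x {}\<close> is the
  homogeneous form of \<open>A\<close>, and \<open>pform V c (k - 1) x {i}\<close> is the \<open>i\<close>th coordinate of \<open>A x\<close>.\<close>

primrec pform :: "'a set \<Rightarrow> ('a set \<Rightarrow> real) \<Rightarrow> nat \<Rightarrow> ('a \<Rightarrow> real) \<Rightarrow> 'a set \<Rightarrow> real" where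
  "pform V c 0 x a = c a"
| "pform V c (Suc m) x a = (\<Sum>i\<in>V. x i * pform V c m x (insert i a))"

lemma sum_lists_Suc:
  fixes f :: "'a list \<Rightarrow> 'b::comm_monoid_add"
  assumes "finite V"
  shows "(\<Sum>js | length js = Suc m \<and> set js \<subseteq> V. f js)
       = (\<Sum>i\<in>V. \<Sum>js | length js = m \<and> set js \<subseteq> V. f (i # js))"
proof -
  have eq: "{js. length js = Suc m \<and> set js \<subseteq> V}
      = (\<lambda>(i, js). i # js) ` (V \<times> {js. length js = m \<and> set js \<subseteq> V})"
    by (auto simp: length_Suc_conv)
  have inj: "inj_on (\<lambda>(i, js). i # js) (V \<times> {js. length js = m \<and> set js \<subseteq> V})"
    by (auto simp: inj_on_def)
  show ?thesis
    unfolding eq sum.reindex[OF inj]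
    by (simp add: sum.cartesian_product case_prod_beta)
qed

lemma pform_eq_sum_lists:
  assumes "finite V"
  shows "(\<Sum>js | length js = m \<and> set js \<subseteq> V. c (a \<union> set js) * prod_list (map y js))
       = pform V c m y a"
proof (induction m arbitrary: a)
  case 0
  have "{js. length js = 0 \<and> set js \<subseteq> V} = {[]}" by auto
  then show ?case by simp
next
  case (Suc m)
  show ?case
    unfolding sum_lists_Suc[OF assms]
    by (simp add: Suc.IH[symmetric] sum_distrib_left mult_ac)
qed

lemma pform_nonneg:
  assumes "\<And>b. c b \<ge> 0" "\<And>i. i \<in> V \<Longrightarrow> x i \<ge> 0"
  shows "pform V c m x a \<ge> 0"
  by (induction m arbitrary: a) (auto intro!: sum_nonneg mult_nonneg_nonneg assms)

lemma pform_mono: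
  assumes "\<And>b. c b \<ge> 0" "\<And>i. i \<in> V \<Longrightarrow> 0 \<le> x i" "\<And>i. i \<in> V \<Longrightarrow> x i \<le> y i"
  shows "pform V c m x a \<le> pform V c m y a"
proof (induction m arbitrary: a)
  case (Suc m)
  show ?case unfolding pform.simps
    by (intro sum_mono mult_mono Suc.IH assms pform_nonneg) (use assms order_trans in blast)+
qed simp

lemma pform_cong:
  assumes "\<And>i. i \<in> V \<Longrightarrow> x i = y i"
  shows "pform V c m x a = pform V c m y a"
  by (induction m arbitrary: a) (auto intro!: sum.cong simp: assms)

lemma pform_scale: "pform V c m (\<lambda>i. s * x i) a = s ^ m * pform V c m x a"
  by (induction m arbitrary: a) (simp_all add: sum_distrib_left mult_ac)

lemma pform_sum: "pform V (\<lambda>a. \<Sum>e\<in>E. d e a) m x a = (\<Sum>e\<in>E. pform V (d e) m x a)"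
proof (induction m arbitrary: a)
  case (Suc m)
  show ?case by (simp add: Suc.IH sum_distrib_left) (rule sum.swap)
qed simp

lemma continuous_on_pform: "continuous_on S (\<lambda>x. pform V c m x a)"
proof (induction m arbitrary: a)
  case (Suc m)
  have "continuous_on S (\<lambda>x::'a \<Rightarrow> real. x i)" for i
    by (rule continuous_on_subset[OF continuous_on_product_coordinates subset_UNIV])
  then show ?case unfolding pform.simps
    by (intro continuous_intros Suc.IH)
qed simp

text \<open>The partial derivative of a form of degree \<open>m\<close> in the direction \<open>i\<close>.\<close>

lemma has_real_derivative_pform:
  assumes "finite V" "i \<in> V"
  shows "((\<lambda>t. pform V c m (\<lambda>j. x j + (if j = i then t else 0)) a)
    has_real_derivative real m * pform V c (m - 1) x (insert i a)) (at 0)"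
proof (induction m arbitrary: a)
  case 0
  show ?case by simp
next
  case (Suc m)
  let ?x = "\<lambda>t j. x j + (if j = i then t else 0)"
  have x0: "?x 0 = x" by auto
  have d: "((\<lambda>t. ?x t j) has_real_derivative (if j = i then 1 else 0)) (at 0)" for j
    by (auto intro!: derivative_eq_intros)
  have "((\<lambda>t. \<Sum>j\<in>V. ?x t j * pform V c m (?x t) (insert j a)) has_real_derivative
     (\<Sum>j\<in>V. (if j = i then 1 else 0) * pform V c m (?x 0) (insert j a)
         + (real m * pform V c (m - 1) x (insert i (insert j a))) * ?x 0 j)) (at 0)"
    by (intro DERIV_sum DERIV_mult d Suc.IH)
  also have "(\<Sum>j\<in>V. (if j = i then 1 else 0) * pform V c m (?x 0) (insert j a)
         + (real m * pform V c (m - 1) x (insert i (insert j a))) * ?x 0 j)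
      = (\<Sum>j\<in>V. (if j = i then pform V c m x (insert j a) else 0)
        + real m * (x j * pform V c (m - 1) x (insert j (insert i a))))"
    unfolding x0 by (intro sum.cong) (auto simp: insert_commute)
  also have "\<dots> = (\<Sum>j\<in>V. if j = i then pform V c m x (insert j a) else 0)
        + real m * (\<Sum>j\<in>V. x j * pform V c (m - 1) x (insert j (insert i a)))"
    by (simp only: sum.distrib sum_distrib_left)
  also have "real m * (\<Sum>j\<in>V. x j * pform V c (m - 1) x (insert j (insert i a)))
      = real m * pform V c m x (insert i a)"
    by (cases m) simp_all
  also have "(\<Sum>j\<in>V. if j = i then pform V c m x (insert j a) else 0) = pform V c m x (insert i a)"
    using assms by (simp add: sum.delta')
  finally show ?case by (simp add: algebra_simps)
qed

section \<open>The variational principle\<close>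

text \<open>The \<open>k\<close>th power of the \<open>k\<close>-norm of a nonnegative vector.\<close>

definition pnorm :: "'a set \<Rightarrow> nat \<Rightarrow> ('a \<Rightarrow> real) \<Rightarrow> real" where
  "pnorm V k x = (\<Sum>i\<in>V. x i ^ k)"

text \<open>The nonnegative nonzero vector \<open>x\<close> maximises the quotient of the form by \<open>pnorm V k\<close> over
  all such vectors, and \<open>r\<close> is the maximum. The condition on all \<open>y\<close> is stated without a division;
  \<open>y = 0\<close> satisfies it trivially when \<open>k \<ge> 1\<close>.\<close>

definition rayleigh_max :: "'a set \<Rightarrow> nat \<Rightarrow> ('a set \<Rightarrow> real) \<Rightarrow> real \<Rightarrow> ('a \<Rightarrow> real) \<Rightarrow> bool" where
  "rayleigh_max V k c r x \<longleftrightarrow>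
     (\<forall>i\<in>V. x i \<ge> 0) \<and> (\<exists>i\<in>V. x i > 0) \<and> pform V c k x {} = r * pnorm V k x \<and>
     (\<forall>y. (\<forall>i\<in>V. y i \<ge> 0) \<longrightarrow> pform V c k y {} \<le> r * pnorm V k y)"

lemma pnorm_pos:
  assumes "finite V" "\<forall>i\<in>V. x i \<ge> 0" "\<exists>i\<in>V. x i > 0"
  shows "pnorm V k x > 0"
proof -
  obtain i where "i \<in> V" "x i > 0" using assms(3) by blast
  then show ?thesis unfolding pnorm_def
    using assms(1,2) by (intro sum_pos2[where i = i]) auto
qed

lemma rayleigh_max_exists:
  assumes V: "finite V" "V \<noteq> {}" and k: "k \<ge> 1"
  obtains r x where "rayleigh_max V k c r x"
proof -
  \<comment> \<open>The quotient is homogeneous of degree 0, so it suffices to maximise it over the standard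
    simplex, where its denominator does not vanish. Coordinates outside \<open>V\<close> are set to \<open>0\<close> to
    make the simplex compact in the product topology.\<close>
  let ?B = "PiE UNIV (\<lambda>i. if i \<in> V then {0..1::real} else {0})"
  let ?S = "?B \<inter> {x. (\<Sum>i\<in>V. x i) = 1}"
  let ?q = "\<lambda>x. pform V c k x {} / pnorm V k x"
  have co: "continuous_on A (\<lambda>x::'a \<Rightarrow> real. x i)" for i A
    by (rule continuous_on_subset[OF continuous_on_product_coordinates subset_UNIV])
  have "compactin (product_topology (\<lambda>i::'a. euclideanreal) UNIV) ?B"
    by (auto simp: compactin_PiE)
  then have "compact ?B"
    by (simp add: euclidean_product_topology)
  moreover have "closed {x::'a \<Rightarrow> real. (\<Sum>i\<in>V. x i) = 1}"
    by (intro closed_Collect_eq continuous_on_sum continuous_on_const co)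
  ultimately have S: "compact ?S" by (rule compact_Int_closed)
  have pos: "pnorm V k x > 0" if "x \<in> ?S" for x
  proof (rule pnorm_pos[OF V(1)])
    have mem: "x i \<in> (if i \<in> V then {0..1::real} else {0})" for i
      using that by (auto simp: PiE_iff)
    show nn: "\<forall>i\<in>V. x i \<ge> 0"
    proof
      fix i assume "i \<in> V" then show "x i \<ge> 0" using mem[of i] by simp
    qed
    show "\<exists>i\<in>V. x i > 0"
    proof (rule ccontr)
      assume "\<not> ?thesis"
      then have "(\<Sum>i\<in>V. x i) \<le> 0" by (intro sum_nonpos) (auto simp: not_less)
      then show False using that by simp
    qed
  qed
  have cq: "continuous_on ?S ?q"
  proof (rule continuous_on_divide[OF continuous_on_pform])
    show "continuous_on ?S (pnorm V k)" unfolding pnorm_def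
      by (intro continuous_on_sum continuous_on_power co)
    show "\<forall>x\<in>?S. pnorm V k x \<noteq> 0" using pos by force
  qed
  have ne: "?S \<noteq> {}"
  proof -
    obtain v where v: "v \<in> V" using V by blast
    have "(\<Sum>i\<in>V. (if i = v then 1 else 0::real)) = 1" using v V by simp
    then have "(\<lambda>i. if i = v then 1 else 0::real) \<in> ?S" using v by (auto simp: PiE_iff)
    then show ?thesis by blast
  qed
  obtain x where x: "x \<in> ?S" "\<And>y. y \<in> ?S \<Longrightarrow> ?q y \<le> ?q x"
    using continuous_attains_sup[OF S ne cq] by blast
  have xn: "x i \<ge> 0" if "i \<in> V" for i
    using x(1) that by (auto simp: PiE_iff split: if_splits dest: spec[of _ i])
  have "pform V c k y {} \<le> ?q x * pnorm V k y" if y: "\<forall>i\<in>V. y i \<ge> 0" for y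
  proof (cases "\<exists>i\<in>V. y i > 0")
    case True
    define s where "s = (\<Sum>i\<in>V. y i)"
    have s: "s > 0" unfolding s_def using True y V by (meson sum_pos2)
    define z where "z = (\<lambda>i. if i \<in> V then y i / s else 0)"
    have zs: "(\<Sum>i\<in>V. z i) = 1"
      using s by (simp add: z_def s_def sum_divide_distrib[symmetric])
    have "y i \<le> s" if "i \<in> V" for i unfolding s_def
      using that y V by (intro member_le_sum) auto
    then have zS: "z \<in> ?S" using y s zs by (auto simp: z_def PiE_iff)
    have yz: "\<And>i. i \<in> V \<Longrightarrow> y i = s * z i" using s by (simp add: z_def)
    have 1: "pform V c k y {} = s ^ k * pform V c k z {}"
      using pform_cong[of V y "\<lambda>i. s * z i"] yz pform_scale by metis
    have 2: "pnorm V k y = s ^ k * pnorm V k z"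
      unfolding pnorm_def by (simp add: yz power_mult_distrib sum_distrib_left)
    have "pform V c k z {} \<le> ?q x * pnorm V k z"
      using x(2)[OF zS] pos[OF zS] by (simp add: field_simps)
    then have "s ^ k * pform V c k z {} \<le> s ^ k * (?q x * pnorm V k z)"
      using s by (intro mult_left_mono) auto
    then show ?thesis unfolding 1 2 by (simp only: mult.left_commute)
  next
    case False
    then have y0: "\<And>i. i \<in> V \<Longrightarrow> y i = 0" using y by force
    obtain k' where "k = Suc k'" using k by (cases k) auto
    then show ?thesis using y0 by (simp add: pnorm_def)
  qed
  moreover have "\<exists>i\<in>V. x i > 0"
  proof (rule ccontr)
    assume "\<not> ?thesis"
    then have "(\<Sum>i\<in>V. x i) \<le> 0" by (intro sum_nonpos) (auto simp: not_less)
    then show False using x by simp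
  qed
  ultimately have "rayleigh_max V k c (?q x) x"
    using xn pos[OF x(1)] by (auto simp: rayleigh_max_def)
  then show ?thesis by (rule that)
qed

text \<open>The derivative of \<open>r \<parallel>x\<parallel>\<^sup>k - pform\<close> in the direction \<open>i\<close> is nonnegative for every \<open>i\<close>, as
  increasing \<open>x i\<close> keeps \<open>x\<close> in the nonnegative cone. By homogeneity these derivatives, weighted
  with \<open>x i\<close>, add up to zero; hence the derivative vanishes where \<open>x i > 0\<close>. Where \<open>x i = 0\<close>, it is minus a
  nonnegative number and vanishes as well.\<close>

lemma rayleigh_max_eigen:
  assumes V: "finite V" and k: "k \<ge> 2" and c: "\<And>b. c b \<ge> 0"
    and R: "rayleigh_max V k c r x" and i: "i \<in> V"
  shows "pform V c (k - 1) x {i} = r * x i ^ (k - 1)"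
proof -
  have xn: "\<And>j. j \<in> V \<Longrightarrow> x j \<ge> 0" and eq: "pform V c k x {} = r * pnorm V k x"
    and le: "\<And>y. (\<And>j. j \<in> V \<Longrightarrow> y j \<ge> 0) \<Longrightarrow> pform V c k y {} \<le> r * pnorm V k y"
    using R by (auto simp: rayleigh_max_def)
  define D where "D j = r * x j ^ (k - 1) - pform V c (k - 1) x {j}" for j
  have Dn: "D j \<ge> 0" if j: "j \<in> V" for j
  proof (rule ccontr)
    assume neg: "\<not> D j \<ge> 0"
    let ?x = "\<lambda>t l. x l + (if l = j then t else 0)"
    let ?f = "\<lambda>t. r * (\<Sum>l\<in>V. ?x t l ^ k) - pform V c k (?x t) {}"
    have dN: "((\<lambda>t. \<Sum>l\<in>V. ?x t l ^ k) has_real_derivative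
        (\<Sum>l\<in>V. if l = j then real k * x j ^ (k - 1) else 0)) (at 0)"
      by (intro DERIV_sum) (auto intro!: derivative_eq_intros)
    have "(?f has_real_derivative r * (real k * x j ^ (k - 1)) - real k * pform V c (k - 1) x {j}) (at 0)"
      using DERIV_diff[OF DERIV_cmult[OF dN, of r] has_real_derivative_pform[OF V j, of c k x "{}"]] V j
      by simp
    moreover have "r * (real k * x j ^ (k - 1)) - real k * pform V c (k - 1) x {j} = real k * D j"
      by (simp add: D_def algebra_simps)
    moreover have "real k * D j < 0" using neg k by (simp add: mult_pos_neg)
    ultimately have "(?f has_real_derivative real k * D j) (at 0)" "real k * D j < 0" by simp_all
    from DERIV_neg_dec_right[OF this]
    obtain d where d: "d > 0" "\<And>h. h > 0 \<Longrightarrow> h < d \<Longrightarrow> ?f 0 > ?f (0 + h)" by blast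
    have f0: "?f 0 = 0" using eq by (simp add: pnorm_def)
    have "?f (d / 2) \<ge> 0" using le[of "?x (d / 2)"] xn d(1) by (simp add: pnorm_def)
    moreover have "?f (d / 2) < 0" using d(2)[of "d / 2", unfolded add_0] d(1) f0 by simp
    ultimately show False by simp
  qed
  have kS: "k = Suc (k - 1)" using k by simp
  have e1: "x j * x j ^ (k - 1) = x j ^ k" for j using kS by (metis power_Suc)
  have "(\<Sum>j\<in>V. x j * D j) = r * pnorm V k x - (\<Sum>j\<in>V. x j * pform V c (k - 1) x {j})"
    unfolding D_def pnorm_def
    by (simp add: right_diff_distrib sum_subtractf sum_distrib_left mult.left_commute[of _ r] e1 del: One_nat_def)
  also have "(\<Sum>j\<in>V. x j * pform V c (k - 1) x {j}) = pform V c k x {}"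
    by (subst (2) kS) simp
  finally have "(\<Sum>j\<in>V. x j * D j) = 0" using eq by simp
  then have "x i * D i = 0"
    using sum_nonneg_0[OF V, of "\<lambda>j. x j * D j"] Dn xn i by (metis (no_types, lifting) mult_nonneg_nonneg)
  moreover have "D i = 0" if "x i = 0"
  proof -
    have "pform V c (k - 1) x {i} \<ge> 0" by (rule pform_nonneg[OF c xn])
    then show ?thesis using Dn[OF i] that k by (simp add: D_def power_0_left)
  qed
  ultimately show ?thesis by (auto simp: D_def)
qed

text \<open>The maximum is an eigenvalue by the preceding lemma. It bounds the modulus of every
  eigenvalue \<open>l\<close>, since the moduli \<open>y\<close> of the coordinates of an eigenvector satisfy
  \<open>\<bar>l\<bar> y\<^sub>i\<^bsup>k-1\<^esup> \<le> (A y)\<^sub>i\<close>.\<close>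

lemma spectral_radius_rayleigh_max:
  assumes V: "finite V" and k: "k \<ge> 2" and c: "\<And>b. c b \<ge> 0"
    and A: "\<And>js. length js = k \<Longrightarrow> set js \<subseteq> V \<Longrightarrow> A js = c (set js)"
    and R: "rayleigh_max V k c r x"
  shows "spectral_radius k V A = r"
proof -
  have xn: "\<And>j. j \<in> V \<Longrightarrow> x j \<ge> 0" and xp: "\<exists>j\<in>V. x j > 0"
    and eq: "pform V c k x {} = r * pnorm V k x"
    and le: "\<And>y. (\<And>j. j \<in> V \<Longrightarrow> y j \<ge> 0) \<Longrightarrow> pform V c k y {} \<le> r * pnorm V k y"
    using R by (auto simp: rayleigh_max_def)
  have kS: "k = Suc (k - 1)" using k by simp
  have r0: "r \<ge> 0"
  proof -
    have "pnorm V k x > 0" using pnorm_pos[OF V] xn xp by blast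
    moreover have "pform V c k x {} \<ge> 0" by (rule pform_nonneg[OF c xn])
    ultimately show ?thesis using eq by (simp add: zero_le_mult_iff)
  qed
  have app: "tensor_apply k V A z i
      = (\<Sum>js | length js = k - 1 \<and> set js \<subseteq> V. complex_of_real (c ({i} \<union> set js)) * prod_list (map z js))"
    if "i \<in> V" for z i
    unfolding tensor_apply_def using that k by (intro sum.cong) (auto simp: A)
  have "tensor_eigenvalue k V A (complex_of_real r)"
    unfolding tensor_eigenvalue_def
  proof (intro exI[of _ "\<lambda>i. complex_of_real (x i)"] conjI ballI)
    show "\<exists>i\<in>V. complex_of_real (x i) \<noteq> 0" using xp by force
    fix i assume i: "i \<in> V"
    have pl: "prod_list (map (\<lambda>i. complex_of_real (x i)) js) = complex_of_real (prod_list (map x js))" for js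
      by (induction js) simp_all
    have "tensor_apply k V A (\<lambda>i. complex_of_real (x i)) i = complex_of_real (pform V c (k - 1) x {i})"
      unfolding app[OF i] pform_eq_sum_lists[OF V, symmetric] pl by simp
    then show "tensor_apply k V A (\<lambda>i. complex_of_real (x i)) i
        = complex_of_real r * complex_of_real (x i) ^ (k - 1)"
      unfolding rayleigh_max_eigen[OF V k c R i] by simp
  qed
  moreover have "cmod l \<le> r" if l: "tensor_eigenvalue k V A l" for l
  proof -
    obtain z where z: "\<exists>i\<in>V. z i \<noteq> 0" "\<forall>i\<in>V. tensor_apply k V A z i = l * z i ^ (k - 1)"
      using l unfolding tensor_eigenvalue_def by blast
    let ?y = "\<lambda>i. cmod (z i)"
    have pl: "cmod (prod_list (map z js)) = prod_list (map ?y js)" for js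
      by (induction js) (simp_all add: norm_mult)
    have b: "cmod l * ?y i ^ (k - 1) \<le> pform V c (k - 1) ?y {i}" if i: "i \<in> V" for i
    proof -
      have "cmod l * ?y i ^ (k - 1) = cmod (tensor_apply k V A z i)"
        using z i by (simp add: norm_mult norm_power)
      also have "\<dots> \<le> (\<Sum>js | length js = k - 1 \<and> set js \<subseteq> V. c ({i} \<union> set js) * prod_list (map ?y js))"
        unfolding app[OF i] by (rule order_trans[OF norm_sum]) (simp add: norm_mult pl c)
      finally show ?thesis unfolding pform_eq_sum_lists[OF V] .
    qed
    have "cmod l * pnorm V k ?y = (\<Sum>i\<in>V. ?y i * (cmod l * ?y i ^ (k - 1)))"
      unfolding pnorm_def by (subst (1) kS) (simp add: sum_distrib_left mult_ac)
    also have "\<dots> \<le> (\<Sum>i\<in>V. ?y i * pform V c (k - 1) ?y {i})"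
      by (intro sum_mono mult_left_mono b) auto
    also have "\<dots> = pform V c k ?y {}" by (subst (2) kS) simp
    also have "\<dots> \<le> r * pnorm V k ?y" by (rule le) simp
    finally have "cmod l * pnorm V k ?y \<le> r * pnorm V k ?y" .
    moreover have "pnorm V k ?y > 0" by (rule pnorm_pos[OF V]) (use z in auto)
    ultimately show ?thesis by simp
  qed
  ultimately show ?thesis
    unfolding spectral_radius_def using r0
    by (intro cSup_eq_maximum) (auto intro!: exI[of _ "complex_of_real r"])
qed

section \<open>Tensors of hypergraphs\<close>

text \<open>The adjacency, signless Laplacian and incidence \<open>Q\<close>-tensors are all sums over the edges: an
  edge \<open>e\<close> contributes \<open>g (card a)\<close> to the entries whose indices have underlying set \<open>a \<subseteq> e\<close>. Only
  the function \<open>g \<ge> 0\<close>, with \<open>g k > 0\<close>, differs.\<close>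

definition edge_weight :: "(nat \<Rightarrow> real) \<Rightarrow> 'a set \<Rightarrow> 'a set \<Rightarrow> real" where
  "edge_weight g e a = (if a \<subseteq> e then g (card a) else 0)"

text \<open>The entry, at sequences with underlying set \<open>a\<close>, of the tensor with edge set \<open>E\<close>.\<close>

definition hweight :: "(nat \<Rightarrow> real) \<Rightarrow> 'a set set \<Rightarrow> 'a set \<Rightarrow> real" where
  "hweight g E a = (\<Sum>e\<in>E. edge_weight g e a)"

lemma edge_weight_nonneg: "(\<And>c. g c \<ge> 0) \<Longrightarrow> edge_weight g e a \<ge> 0"
  by (simp add: edge_weight_def)

lemma hweight_nonneg: "(\<And>c. g c \<ge> 0) \<Longrightarrow> hweight g E a \<ge> 0"
  unfolding hweight_def by (intro sum_nonneg edge_weight_nonneg)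

lemma pform_edge_weight_eq_0:
  "\<not> a \<subseteq> e \<Longrightarrow> pform V (edge_weight g e) m x a = 0"
  by (induction m arbitrary: a) (auto simp: edge_weight_def)

lemma pform_edge_weight_restrict:
  assumes "finite V" "e \<subseteq> V"
  shows "pform V (edge_weight g e) m x a = pform e (edge_weight g e) m x a"
proof (induction m arbitrary: a)
  case (Suc m)
  show ?case unfolding pform.simps Suc.IH
    by (rule sum.mono_neutral_right[OF assms]) (auto simp: pform_edge_weight_eq_0)
qed simp

lemma pform_hweight:
  assumes "finite V" "\<And>e. e \<in> E \<Longrightarrow> e \<subseteq> V"
  shows "pform V (hweight g E) m x a = (\<Sum>e\<in>E. pform e (edge_weight g e) m x a)"
proof -
  have "hweight g E = (\<lambda>a. \<Sum>e\<in>E. edge_weight g e a)"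
    by (simp add: hweight_def fun_eq_iff)
  then have "pform V (hweight g E) m x a = (\<Sum>e\<in>E. pform V (edge_weight g e) m x a)"
    by (simp add: pform_sum)
  also have "\<dots> = (\<Sum>e\<in>E. pform e (edge_weight g e) m x a)"
    using assms by (intro sum.cong pform_edge_weight_restrict) auto
  finally show ?thesis .
qed

text \<open>The lower bound is the contribution of a single sequence that enumerates \<open>e - a\<close>.\<close>

lemma pform_edge_ge_prod:
  assumes "finite e" "\<And>c. g c \<ge> 0" "\<And>i. i \<in> e \<Longrightarrow> x i \<ge> 0" "a \<subseteq> e" "card (e - a) = m"
  shows "g (card e) * prod x (e - a) \<le> pform e (edge_weight g e) m x a"
  using assms(4,5)
proof (induction m arbitrary: a)
  case 0
  then have "a = e" using assms(1) by auto
  then show ?case by (simp add: edge_weight_def)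
next
  case (Suc m)
  then obtain i where i: "i \<in> e - a" by (metis card_gt_0_iff ex_in_conv zero_less_Suc)
  have split: "e - a = insert i (e - insert i a)" using i by auto
  have c: "card (e - insert i a) = m"
    using Suc.prems(2) assms(1) split by (metis card_insert_disjoint Diff_iff finite_Diff insertI1 nat.inject)
  have "prod x (e - a) = x i * prod x (e - insert i a)"
    using assms(1) by (subst split) simp
  then have "g (card e) * prod x (e - a) = x i * (g (card e) * prod x (e - insert i a))" by simp
  also have "\<dots> \<le> x i * pform e (edge_weight g e) m x (insert i a)"
    using i c Suc.prems(1) assms(3) by (intro mult_left_mono Suc.IH) auto
  also have "\<dots> \<le> (\<Sum>i\<in>e. x i * pform e (edge_weight g e) m x (insert i a))"
    using i assms(1,3)
    by (intro member_le_sum mult_nonneg_nonneg pform_nonneg edge_weight_nonneg assms(2)) auto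
  finally show ?case by simp
qed

lemma pform_bij_betw:
  assumes h: "bij_betw h V1 V2" and c: "\<And>a. a \<subseteq> V1 \<Longrightarrow> c2 (h ` a) = c1 a" and a: "a \<subseteq> V1"
  shows "pform V2 c2 m y (h ` a) = pform V1 c1 m (\<lambda>i. y (h i)) a"
  using a
proof (induction m arbitrary: a)
  case 0
  then show ?case by (simp add: c)
next
  case (Suc m)
  have "(\<Sum>j\<in>V2. y j * pform V2 c2 m y (insert j (h ` a)))
      = (\<Sum>i\<in>V1. y (h i) * pform V2 c2 m y (insert (h i) (h ` a)))"
    by (rule sum.reindex_bij_betw[OF h, symmetric])
  also have "\<dots> = (\<Sum>i\<in>V1. y (h i) * pform V1 c1 m (\<lambda>i. y (h i)) (insert i a))"
  proof (rule sum.cong)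
    fix i assume "i \<in> V1"
    then have "insert i a \<subseteq> V1" using Suc.prems by auto
    from Suc.IH[OF this]
    show "y (h i) * pform V2 c2 m y (insert (h i) (h ` a)) = y (h i) * pform V1 c1 m (\<lambda>i. y (h i)) (insert i a)"
      by simp
  qed simp
  finally show ?case by simp
qed

lemma edge_weight_image:
  assumes "inj_on h V" "e \<subseteq> V" "a \<subseteq> V"
  shows "edge_weight g (h ` e) (h ` a) = edge_weight g e a"
proof -
  have "h ` a \<subseteq> h ` e \<longleftrightarrow> a \<subseteq> e" using assms by (metis image_mono inj_on_image_mem_iff subsetD subsetI image_eqI)
  moreover have "card (h ` a) = card a" using assms by (meson card_image inj_on_subset)
  ultimately show ?thesis by (simp add: edge_weight_def)
qed

lemma hweight_image:
  assumes "inj_on h V" "\<And>e. e \<in> E \<Longrightarrow> e \<subseteq> V" "a \<subseteq> V"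
  shows "hweight g ((\<lambda>e. h ` e) ` E) (h ` a) = hweight g E a"
proof -
  have "inj_on (\<lambda>e. h ` e) E"
    using assms(1,2) by (auto simp: inj_on_def) (metis assms(1) inj_on_image_eq_iff subsetD image_eqI)+
  then show ?thesis unfolding hweight_def
    by (simp add: sum.reindex edge_weight_image[OF assms(1,2,3)])
qed

lemma rayleigh_max_iso:
  assumes h: "bij_betw h V1 V2" and E1: "\<And>e. e \<in> E1 \<Longrightarrow> e \<subseteq> V1" and E2: "E2 = (\<lambda>e. h ` e) ` E1"
    and R: "rayleigh_max V1 k (hweight g E1) r x"
  shows "rayleigh_max V2 k (hweight g E2) r (\<lambda>j. x (inv_into V1 h j))"
proof -
  have inj: "inj_on h V1" and im: "h ` V1 = V2" using h by (auto simp: bij_betw_def)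
  have P: "pform V2 (hweight g E2) k y {} = pform V1 (hweight g E1) k (\<lambda>i. y (h i)) {}" for y
    using pform_bij_betw[OF h, of "hweight g E2" "hweight g E1" "{}" k y] hweight_image[OF inj E1]
    unfolding E2 by simp
  have N: "pnorm V2 k y = pnorm V1 k (\<lambda>i. y (h i))" for y
    unfolding pnorm_def by (rule sum.reindex_bij_betw[OF h, symmetric])
  have inv: "x (inv_into V1 h (h i)) = x i" if "i \<in> V1" for i
    using inj that by simp
  have "pform V1 (hweight g E1) k (\<lambda>i. x (inv_into V1 h (h i))) {} = pform V1 (hweight g E1) k x {}"
    by (rule pform_cong) (rule inv)
  moreover have "pnorm V1 k (\<lambda>i. x (inv_into V1 h (h i))) = pnorm V1 k x"
    unfolding pnorm_def by (rule sum.cong) (simp_all add: inv)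
  moreover have "(\<forall>j\<in>V2. Q j) \<longleftrightarrow> (\<forall>i\<in>V1. Q (h i))" "(\<exists>j\<in>V2. Q j) \<longleftrightarrow> (\<exists>i\<in>V1. Q (h i))" for Q
    unfolding im[symmetric] by auto
  ultimately show ?thesis
    using R inv unfolding rayleigh_max_def P N by simp
qed

text \<open>If a maximiser vanished on a nonempty set \<open>Z\<close>, then some edge meets \<open>Z\<close> in between \<open>1\<close>
  and \<open>k - 1\<close> vertices. Replacing the zeros by a small \<open>\<epsilon>\<close> raises the form by at least a multiple
  of \<open>\<epsilon>\<^bsup>k-1\<^esup>\<close> but the norm only by a multiple of \<open>\<epsilon>\<^bsup>k\<^esup>\<close>.\<close>

lemma rayleigh_max_pos:
  assumes V: "finite V" and k: "k \<ge> 2" and g: "\<And>c. g c \<ge> 0" "g k > 0"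
    and E: "\<And>e. e \<in> E \<Longrightarrow> e \<subseteq> V \<and> card e = k"
    and cross: "\<And>W. W \<subseteq> V \<Longrightarrow> W \<noteq> {} \<Longrightarrow> W \<noteq> V \<Longrightarrow> \<exists>e\<in>E. e \<inter> W \<noteq> {} \<and> e - W \<noteq> {}"
    and R: "rayleigh_max V k (hweight g E) r x" and i0: "i0 \<in> V"
  shows "x i0 > 0"
proof (rule ccontr)
  assume "\<not> x i0 > 0"
  have xn: "\<And>j. j \<in> V \<Longrightarrow> x j \<ge> 0" and xp: "\<exists>j\<in>V. x j > 0"
    and eq: "pform V (hweight g E) k x {} = r * pnorm V k x"
    and le: "\<And>y. (\<And>j. j \<in> V \<Longrightarrow> y j \<ge> 0) \<Longrightarrow> pform V (hweight g E) k y {} \<le> r * pnorm V k y"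
    using R by (auto simp: rayleigh_max_def)
  define Z where "Z = {i \<in> V. x i = 0}"
  have "i0 \<in> Z" using xn[OF i0] \<open>\<not> x i0 > 0\<close> i0 by (simp add: Z_def)
  moreover have "Z \<noteq> V" using xp unfolding Z_def by force
  ultimately obtain e i j where e: "e \<in> E" and i: "i \<in> e" "i \<in> Z" and j: "j \<in> e" "j \<notin> Z"
    using cross[of Z] by (auto simp: Z_def)
  have eV: "e \<subseteq> V" "card e = k" using E[OF e] by auto
  have fe: "finite e" using eV V finite_subset by blast
  have fE: "finite E" using E V by (meson finite_Pow_iff finite_subset PowI subsetI)
  have xj: "x j > 0" using j eV xn[of j] by (auto simp: Z_def order_less_le)
  define B where "B = r * real (card Z)"
  define C where "C = g k * x j"
  have C: "C > 0" using g xj by (simp add: C_def)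
  obtain d where d: "d > 0" "\<And>l. l \<in> V - Z \<Longrightarrow> d \<le> x l"
  proof (rule that)
    have fin: "finite (insert 1 (x ` (V - Z)))" using V by simp
    show "Min (insert 1 (x ` (V - Z))) > 0"
      using xn by (subst Min_gr_iff[OF fin]) (auto simp: Z_def order_less_le)
    show "\<And>l. l \<in> V - Z \<Longrightarrow> Min (insert 1 (x ` (V - Z))) \<le> x l" using fin by auto
  qed
  \<comment> \<open>\<open>t\<close> plays the role of \<open>\<epsilon>\<close>: at most every nonzero coordinate of \<open>x\<close>, and so small that
    \<open>B t < C\<close>.\<close>
  define t where "t = min d (C / (2 * (\<bar>B\<bar> + 1)))"
  have t: "t > 0" "t \<le> d" using d C by (auto simp: t_def)
  have tC: "t * (\<bar>B\<bar> + 1) \<le> C / 2"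
  proof -
    have "t * (\<bar>B\<bar> + 1) \<le> C / (2 * (\<bar>B\<bar> + 1)) * (\<bar>B\<bar> + 1)"
      by (intro mult_right_mono) (auto simp: t_def)
    also have "\<dots> = C / 2" by (simp add: field_simps add_nonneg_eq_0_iff)
    finally show ?thesis .
  qed
  define y where "y l = (if l \<in> Z then t else x l)" for l
  have yt: "y l \<ge> t" if "l \<in> V" for l using that t d(2)[of l] by (auto simp: y_def)
  have yn: "y l \<ge> 0" if "l \<in> V" for l using yt[OF that] t by simp
  have xy: "x l \<le> y l" if "l \<in> V" for l using that t by (auto simp: y_def Z_def)
  note ew = edge_weight_nonneg[OF g(1)]
  have kS: "k = Suc (k - 1)" "k - 1 = Suc (k - 2)" using k by auto
  have ge: "pform e' (edge_weight g e') m x a \<le> pform e' (edge_weight g e') m y a" if "e' \<in> E" for e' m a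
    using E[OF that] xn xy by (intro pform_mono ew) auto
  have "t ^ (k - 2) = (\<Prod>l\<in>e - {i} - {j}. t)"
    using eV i j fe by (auto simp: Z_def card_Diff_singleton_if numeral_2_eq_2 j)
  also have "\<dots> \<le> prod y (e - {i} - {j})" using yt t eV by (intro prod_mono) auto
  finally have "x j * t ^ (k - 2) \<le> y j * prod y (e - {i} - {j})"
    using xj j by (intro mult_mono) (auto simp: y_def t less_imp_le)
  also have "\<dots> = prod y (e - {i})"
    using fe i j by (intro prod.remove[symmetric]) auto
  finally have "g k * (x j * t ^ (k - 2)) \<le> g (card e) * prod y (e - {i})"
    using g eV by (simp add: mult_left_mono)
  also have "\<dots> \<le> pform e (edge_weight g e) (k - 1) y {i}"
    using eV fe i yn by (intro pform_edge_ge_prod g) auto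
  finally have "t * (C * t ^ (k - 2)) \<le> t * pform e (edge_weight g e) (k - 1) y {i}"
    using t by (simp add: C_def mult.assoc)
  then have inc: "C * t ^ (k - 1) \<le> y i * pform e (edge_weight g e) (k - 1) y {i}"
  proof -
    have "t ^ (k - 1) = t * t ^ (k - 2)" by (subst kS(2)) simp
    moreover have "y i = t" using i by (simp add: y_def)
    ultimately show ?thesis using \<open>t * (C * t ^ (k - 2)) \<le> _\<close> by (simp only: mult.left_commute)
  qed
  have step: "pform e (edge_weight g e) k x {} + C * t ^ (k - 1) \<le> pform e (edge_weight g e) k y {}"
  proof -
    let ?p = "\<lambda>x l. x l * pform e (edge_weight g e) (k - 1) x {l}"
    have F: "pform e (edge_weight g e) k x {} = ?p x i + (\<Sum>l\<in>e - {i}. ?p x l)" for x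
      by (subst kS(1)) (simp add: sum.remove[OF fe i(1)])
    have "x i = 0" using i by (simp add: Z_def)
    moreover have "(\<Sum>l\<in>e - {i}. ?p x l) \<le> (\<Sum>l\<in>e - {i}. ?p y l)"
      using eV xn yn xy ge[OF e] by (intro sum_mono mult_mono pform_nonneg ew) auto
    ultimately show ?thesis using inc unfolding F by simp
  qed
  have "pform V (hweight g E) k x {} + C * t ^ (k - 1) \<le> pform V (hweight g E) k y {}"
  proof -
    have F: "pform V (hweight g E) k x {} = pform e (edge_weight g e) k x {}
        + (\<Sum>e\<in>E - {e}. pform e (edge_weight g e) k x {})" for x
      using E by (simp add: pform_hweight[OF V] sum.remove[OF fE e])
    have "(\<Sum>e\<in>E - {e}. pform e (edge_weight g e) k x {}) \<le> (\<Sum>e\<in>E - {e}. pform e (edge_weight g e) k y {})"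
      by (intro sum_mono ge) auto
    then show ?thesis using step unfolding F by simp
  qed
  also have "\<dots> \<le> r * pnorm V k y" using le yn by simp
  also have "pnorm V k y = pnorm V k x + real (card Z) * t ^ k"
  proof -
    have "pnorm V k y = (\<Sum>l\<in>V. x l ^ k + (if l \<in> Z then t ^ k else 0))"
      unfolding pnorm_def using k by (intro sum.cong) (auto simp: y_def Z_def)
    also have "\<dots> = pnorm V k x + (\<Sum>l\<in>V \<inter> Z. t ^ k)"
      unfolding sum.distrib pnorm_def sum.inter_restrict[OF V] ..
    also have "V \<inter> Z = Z" by (auto simp: Z_def)
    finally show ?thesis by simp
  qed
  finally have "C * t ^ (k - 1) \<le> B * t ^ k"
    using eq by (simp add: B_def algebra_simps)
  also have "B * t ^ k = (B * t) * t ^ (k - 1)" by (subst kS(1)) simp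
  finally have "C \<le> B * t" using t by (simp add: mult_le_cancel_right)
  also have "\<dots> \<le> t * (\<bar>B\<bar> + 1)" using t by (simp add: mult.commute mult_left_mono)
  finally show False using tC C by simp
qed

section \<open>Rooted supertrees\<close>

text \<open>In a supertree with root \<open>u\<close>, let \<open>p e\<close> be the vertex of the edge \<open>e\<close> nearest to \<open>u\<close>. All that
  is needed of \<open>p\<close> is that the sets \<open>e - {p e}\<close> partition the vertices other than \<open>u\<close>.\<close>

definition rooted :: "'a set \<Rightarrow> 'a set set \<Rightarrow> 'a \<Rightarrow> ('a set \<Rightarrow> 'a) \<Rightarrow> bool" where
  "rooted V E u p \<longleftrightarrow>
     (\<forall>e\<in>E. p e \<in> e \<and> u \<notin> e - {p e}) \<and> V = insert u (\<Union>e\<in>E. e - {p e}) \<and>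
     (\<forall>e\<in>E. \<forall>e'\<in>E. e \<noteq> e' \<longrightarrow> (e - {p e}) \<inter> (e' - {p e'}) = {})"

lemma hconnected_crossing_edge:
  assumes "hconnected H" "a \<in> W" "a \<in> verts H" "b \<in> verts H" "b \<notin> W"
  obtains e where "e \<in> edges H" "e \<inter> W \<noteq> {}" "e - W \<noteq> {}"
proof -
  obtain vs es where p: "hpath H vs es" "hd vs = a" "last vs = b"
    using assms unfolding hconnected_def by blast
  have w: "length vs = length es + 1" "set es \<subseteq> edges H"
    "\<And>r. r < length es \<Longrightarrow> vs ! r \<in> es ! r \<and> vs ! (r + 1) \<in> es ! r"
    using p unfolding hpath_def hwalk_def by auto
  have 0: "vs ! 0 \<in> W" using p w assms by (cases vs) auto
  have last: "vs ! length es \<notin> W" using p(3) w(1) assms(5) last_conv_nth[of vs] by (cases "vs = []") simp_all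
  have "\<exists>r<length es. vs ! r \<in> W \<and> vs ! (r + 1) \<notin> W"
  proof (rule ccontr)
    assume "\<not> ?thesis"
    then have step: "\<And>r. r < length es \<Longrightarrow> vs ! r \<in> W \<Longrightarrow> vs ! Suc r \<in> W" by auto
    have "r \<le> length es \<Longrightarrow> vs ! r \<in> W" for r
      by (induction r) (use 0 step in auto)
    then show False using last by blast
  qed
  then obtain r where r: "r < length es" "vs ! r \<in> W" "vs ! (r + 1) \<notin> W" by blast
  have "es ! r \<in> edges H" using r(1) w(2) nth_mem by blast
  moreover have "es ! r \<inter> W \<noteq> {}" "es ! r - W \<noteq> {}" using r w(3)[OF r(1)] by blast+
  ultimately show ?thesis by (rule that)
qed

text \<open>A connected part of a supertree, with vertex set \<open>W\<close> and edge set \<open>F\<close>, that is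
  already rooted at \<open>u\<close>.\<close>

definition rooted_part :: "'a hypergraph \<Rightarrow> 'a \<Rightarrow> 'a set set \<Rightarrow> 'a set \<Rightarrow> ('a set \<Rightarrow> 'a) \<Rightarrow> bool" where
  "rooted_part H u F W p \<longleftrightarrow> F \<subseteq> edges H \<and> W \<subseteq> verts H \<and> rooted W F u p \<and> (\<forall>e\<in>F. e \<subseteq> W) \<and>
     (\<forall>a\<in>W. \<forall>b\<in>W. \<exists>vs es. hpath H vs es \<and> set vs \<subseteq> W \<and> set es \<subseteq> F \<and> hd vs = a \<and> last vs = b)"

lemma hpath_snoc:
  assumes "hpath H vs es" "e \<in> edges H" "e \<notin> set es" "last vs \<in> e" "b \<in> e" "b \<in> verts H" "b \<notin> set vs"
  shows "hpath H (vs @ [b]) (es @ [e])"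
proof -
  have l: "length vs = length es + 1" using assms(1) by (simp add: hpath_def hwalk_def)
  then have "vs ! length es = last vs" using last_conv_nth[of vs] by (cases "vs = []") simp_all
  then have "(vs @ [b]) ! r \<in> (es @ [e]) ! r \<and> (vs @ [b]) ! (r + 1) \<in> (es @ [e]) ! r"
    if "r < length (es @ [e])" for r
    using that assms l by (cases "r = length es") (auto simp: hpath_def hwalk_def nth_append)
  then show ?thesis using assms l unfolding hpath_def hwalk_def by simp
qed

lemma hpath_Cons:
  assumes "hpath H vs es" "e \<in> edges H" "e \<notin> set es" "hd vs \<in> e" "b \<in> e" "b \<in> verts H" "b \<notin> set vs"
  shows "hpath H (b # vs) (e # es)"
proof -
  have l: "length vs = length es + 1" using assms(1) by (simp add: hpath_def hwalk_def)
  then have "vs ! 0 = hd vs" by (cases vs) auto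
  then have "(b # vs) ! r \<in> (e # es) ! r \<and> (b # vs) ! (r + 1) \<in> (e # es) ! r"
    if "r < length (e # es)" for r
    using that assms by (cases r) (auto simp: hpath_def hwalk_def)
  then show ?thesis using assms l unfolding hpath_def hwalk_def by simp
qed

text \<open>Two common vertices of the part and of a new edge would lie on a cycle.\<close>

lemma rooted_part_unique_contact:
  assumes ac: "hacyclic H" and I: "rooted_part H u F W p"
    and e: "e \<in> edges H" "e \<notin> F" and a: "a \<in> e \<inter> W" and b: "b \<in> e \<inter> W"
  shows "a = b"
proof (rule ccontr)
  assume ab: "a \<noteq> b"
  have paths: "\<forall>a\<in>W. \<forall>b\<in>W. \<exists>vs es. hpath H vs es \<and> set vs \<subseteq> W \<and> set es \<subseteq> F \<and> hd vs = a \<and> last vs = b"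
    using I unfolding rooted_part_def by simp
  have "a \<in> W" "b \<in> W" using a b by auto
  then obtain vs es where p: "hpath H vs es" "set es \<subseteq> F" "hd vs = a" "last vs = b"
    using paths by meson
  have l: "length vs = length es + 1" using p by (simp add: hpath_def hwalk_def)
  have es: "es \<noteq> []"
  proof
    assume "es = []" then have "length vs = 1" using l by simp
    then show False using p ab by (cases vs) auto
  qed
  have vb: "vs ! length es = b" using l p(4) last_conv_nth[of vs] by (cases "vs = []") simp_all
  have va: "a \<in> verts H" using I a unfolding rooted_part_def by blast
  have hdvs: "hd (vs @ [a]) = a" using p l by (cases vs) auto
  have "(vs @ [a]) ! r \<in> (es @ [e]) ! r \<and> (vs @ [a]) ! (r + 1) \<in> (es @ [e]) ! r"
    if "r < length (es @ [e])" for r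
    using that p l a b vb by (cases "r = length es") (auto simp: hpath_def hwalk_def nth_append)
  moreover have "e \<notin> set es" using p(2) e(2) by blast
  moreover have "length (es @ [e]) > 1" using es by (cases es) auto
  ultimately have "hcycle H (vs @ [a]) (es @ [e])"
    using p l e va hdvs unfolding hcycle_def hpath_def hwalk_def by simp
  then show False using ac unfolding hacyclic_def by blast
qed

lemma rooted_part_extend:
  assumes ac: "hacyclic H" and I: "rooted_part H u F W p"
    and e: "e \<in> edges H" "e \<subseteq> verts H" "w \<in> e" "w \<in> W" "\<not> e \<subseteq> W"
  shows "rooted_part H u (insert e F) (W \<union> e) (p(e := w))"
proof -
  have eF: "e \<notin> F" using I e(5) unfolding rooted_part_def by blast
  have eW: "e \<inter> W = {w}" using rooted_part_unique_contact[OF ac I e(1) eF] e by blast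
  have FE: "F \<subseteq> edges H" and WV: "W \<subseteq> verts H" and FW: "\<forall>e\<in>F. e \<subseteq> W" and R: "rooted W F u p"
    and paths: "\<And>a b. a \<in> W \<Longrightarrow> b \<in> W \<Longrightarrow>
      \<exists>vs es. hpath H vs es \<and> set vs \<subseteq> W \<and> set es \<subseteq> F \<and> hd vs = a \<and> last vs = b"
    using I unfolding rooted_part_def by auto
  have uW: "u \<in> W" using R unfolding rooted_def by blast
  let ?p = "p(e := w)"
  have pe: "\<And>e'. e' \<in> F \<Longrightarrow> ?p e' = p e'" using eF by auto
  have "rooted (W \<union> e) (insert e F) u ?p"
    unfolding rooted_def
  proof (intro conjI)
    show "\<forall>e'\<in>insert e F. ?p e' \<in> e' \<and> u \<notin> e' - {?p e'}"
      using R pe e(3) uW eW unfolding rooted_def by auto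
    have "W = insert u (\<Union>e\<in>F. e - {p e})" using R unfolding rooted_def by blast
    also have "(\<Union>e\<in>F. e - {p e}) = (\<Union>e\<in>F. e - {?p e})" using pe by auto
    finally show "W \<union> e = insert u (\<Union>e'\<in>insert e F. e' - {?p e'})" using e(3,4) by auto
    have d: "(e - {w}) \<inter> (e' - {p e'}) = {}" if "e' \<in> F" for e' using that FW eW by blast
    have "(e1 - {p e1}) \<inter> (e2 - {p e2}) = {}" if "e1 \<in> F" "e2 \<in> F" "e1 \<noteq> e2" for e1 e2
      using R that unfolding rooted_def by blast
    then show "\<forall>e1\<in>insert e F. \<forall>e2\<in>insert e F. e1 \<noteq> e2 \<longrightarrow> (e1 - {?p e1}) \<inter> (e2 - {?p e2}) = {}"
      using d by (auto simp: pe) blast+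
  qed
  moreover have "\<exists>vs es. hpath H vs es \<and> set vs \<subseteq> W \<union> e \<and> set es \<subseteq> insert e F \<and> hd vs = a \<and> last vs = b"
    if a: "a \<in> W \<union> e" and b: "b \<in> W \<union> e" for a b
  proof -
    consider "a \<in> W" "b \<in> W" | "a \<in> W" "b \<in> e - W" | "a \<in> e - W" "b \<in> W"
      | "a \<in> e - W" "b \<in> e - W" "a \<noteq> b" | "a \<in> e - W" "a = b"
      using a b by blast
    then show ?thesis
    proof cases
      case 1
      then show ?thesis using paths[of a b] by blast
    next
      case 2
      obtain vs es where p: "hpath H vs es" "set vs \<subseteq> W" "set es \<subseteq> F" "hd vs = a" "last vs = w"
        using paths[OF 2(1) e(4)] by blast
      have "vs \<noteq> []" using p(1) by (auto simp: hpath_def hwalk_def)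
      then have "hd (vs @ [b]) = a" using p by simp
      moreover have "hpath H (vs @ [b]) (es @ [e])"
        using p e 2 eF by (intro hpath_snoc) auto
      ultimately show ?thesis using p 2 by (intro exI[of _ "vs @ [b]"] exI[of _ "es @ [e]"]) auto
    next
      case 3
      obtain vs es where p: "hpath H vs es" "set vs \<subseteq> W" "set es \<subseteq> F" "hd vs = w" "last vs = b"
        using paths[OF e(4) 3(2)] by blast
      have "vs \<noteq> []" using p(1) by (auto simp: hpath_def hwalk_def)
      moreover have "hpath H (a # vs) (e # es)"
        using p e 3 eF by (intro hpath_Cons) auto
      ultimately show ?thesis using p 3 by (intro exI[of _ "a # vs"] exI[of _ "e # es"]) auto
    next
      case 4
      then have "hpath H [a, b] [e]" using e by (auto simp: hpath_def hwalk_def)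
      then show ?thesis using 4 by (intro exI[of _ "[a, b]"] exI[of _ "[e]"]) auto
    next
      case 5
      then have "hpath H [a] []" using e by (auto simp: hpath_def hwalk_def)
      then show ?thesis using 5 by (intro exI[of _ "[a]"] exI[of _ "[]"]) auto
    qed
  qed
  ultimately show ?thesis
    unfolding rooted_part_def using FE WV FW e by blast
qed

text \<open>A rooted part with the largest number of edges is the whole supertree: by connectedness, it
  could otherwise be enlarged by an edge that leaves its vertex set. Once it contains all
  vertices, an edge outside it would meet it in at least two vertices.\<close>

lemma supertree_rooted:
  assumes k: "k \<ge> 2" and H: "uniform_hypergraph k H" "supertree H" and u: "u \<in> verts H"
  obtains p where "rooted (verts H) (edges H) u p"
proof -
  have conn: "hconnected H" and ac: "hacyclic H" using H by (auto simp: supertree_def)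
  have fV: "finite (verts H)" and E: "\<And>e. e \<in> edges H \<Longrightarrow> e \<subseteq> verts H \<and> card e = k"
    using H by (auto simp: uniform_hypergraph_def)
  have fE: "finite (edges H)" using E fV by (meson finite_Pow_iff finite_subset PowI subsetI)
  define Q where "Q c \<longleftrightarrow> (\<exists>F W p. rooted_part H u F W p \<and> card F = c)" for c
  have "hpath H [u] []" using u by (auto simp: hpath_def hwalk_def)
  then have "rooted_part H u {} {u} (\<lambda>_. u)"
    using u by (force simp: rooted_part_def rooted_def)
  then have "Q 0" unfolding Q_def by (metis card.empty)
  moreover have "c \<le> card (edges H)" if "Q c" for c
    using that fE unfolding Q_def rooted_part_def by (auto intro: card_mono)
  ultimately obtain c where c: "Q c" "\<And>c'. Q c' \<Longrightarrow> c' \<le> c"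
    using ex_has_greatest_nat[of Q 0 id "Suc (card (edges H))"] by (auto simp: less_Suc_eq_le)
  obtain F W p where I: "rooted_part H u F W p" and cF: "card F = c" using c(1) Q_def by blast
  have FE: "F \<subseteq> edges H" and WV: "W \<subseteq> verts H" and FW: "\<forall>e\<in>F. e \<subseteq> W" and R: "rooted W F u p"
    using I unfolding rooted_part_def by auto
  have uW: "u \<in> W" using R unfolding rooted_def by blast
  have WV': "W = verts H"
  proof (rule ccontr)
    assume "W \<noteq> verts H"
    then obtain b where "b \<in> verts H" "b \<notin> W" using WV by blast
    then obtain e where e: "e \<in> edges H" "e \<inter> W \<noteq> {}" "e - W \<noteq> {}"
      using hconnected_crossing_edge[OF conn uW u] by metis
    obtain w where "w \<in> e" "w \<in> W" using e by blast
    then have "rooted_part H u (insert e F) (W \<union> e) (p(e := w))"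
      using rooted_part_extend[OF ac I e(1)] e E by blast
    moreover have "card (insert e F) = Suc c"
      using e FW cF fE FE by (subst card_insert_disjoint) (auto intro: finite_subset)
    ultimately have "Q (Suc c)" unfolding Q_def by blast
    then show False using c(2) by force
  qed
  have "F = edges H"
  proof (rule ccontr)
    assume "F \<noteq> edges H"
    then obtain e where e: "e \<in> edges H" "e \<notin> F" using FE by blast
    have "card e \<ge> 2" using E[OF e(1)] k by simp
    then obtain a b where "a \<in> e" "b \<in> e" "a \<noteq> b"
      by (metis card_le_Suc0_iff_eq card.infinite not_less_eq_eq numeral_2_eq_2 zero_le)
    then show False
      using rooted_part_unique_contact[OF ac I e, of a b] E[OF e(1)] WV' by blast
  qed
  then show ?thesis using R WV' that by blast
qed

lemma rooted_parent_eq_root: "rooted V E u p \<Longrightarrow> e \<in> E \<Longrightarrow> u \<in> e \<Longrightarrow> p e = u"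
  by (auto simp: rooted_def)

lemma rooted_card:
  assumes "rooted V E u p" "finite E" "\<And>e. e \<in> E \<Longrightarrow> finite e \<and> card e = k"
  shows "card V = 1 + card E * (k - 1)"
proof -
  have V: "V = insert u (\<Union>e\<in>E. e - {p e})" and pe: "\<And>e. e \<in> E \<Longrightarrow> p e \<in> e"
    and u: "u \<notin> (\<Union>e\<in>E. e - {p e})"
    using assms(1) by (auto simp: rooted_def)
  have "card (\<Union>e\<in>E. e - {p e}) = (\<Sum>e\<in>E. card (e - {p e}))"
    using assms by (intro card_UN_disjoint) (auto simp: rooted_def)
  also have "\<dots> = card E * (k - 1)"
    using assms pe by (simp add: card_Diff_singleton)
  moreover have "finite (\<Union>e\<in>E. e - {p e})" using assms by auto
  ultimately show ?thesis using u unfolding V by simp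
qed

lemma rooted_hyperstar:
  assumes H: "uniform_hypergraph k H" and R: "rooted (verts H) (edges H) u p"
    and all: "\<And>e. e \<in> edges H \<Longrightarrow> u \<in> e"
  shows "is_hyperstar (card (verts H)) k H"
proof -
  have fV: "finite (verts H)" and E: "\<And>e. e \<in> edges H \<Longrightarrow> e \<subseteq> verts H \<and> card e = k"
    using H by (auto simp: uniform_hypergraph_def)
  have fE: "finite (edges H)" using E fV by (meson finite_Pow_iff finite_subset PowI subsetI)
  define m where "m = card (edges H)"
  have "card {1..m} = card (edges H)" by (simp add: m_def)
  then obtain b where b: "bij_betw b {1..m} (edges H)"
    using finite_same_card_bij[OF _ fE, of "{1..m}"] by blast
  have bE: "\<And>i. i \<in> {1..m} \<Longrightarrow> b i \<in> edges H" and binj: "inj_on b {1..m}" and bim: "b ` {1..m} = edges H"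
    using b by (auto simp: bij_betw_def)
  have pu: "\<And>e. e \<in> edges H \<Longrightarrow> p e = u" using rooted_parent_eq_root[OF R] all by blast
  define P where "P i = (if i = 0 then {u} else b i - {u})" for i
  have split: "{0..m} = insert 0 {1..m}" by auto
  have V: "verts H = insert u (\<Union>e\<in>edges H. e - {u})"
    using R pu unfolding rooted_def by auto
  have dis: "(e - {u}) \<inter> (e' - {u}) = {}" if "e \<in> edges H" "e' \<in> edges H" "e \<noteq> e'" for e e'
  proof -
    have "(e - {p e}) \<inter> (e' - {p e'}) = {}" using R that unfolding rooted_def by simp
    then show ?thesis using pu that by simp
  qed
  have "verts H = (\<Union>i\<in>{0..m}. P i)"
    unfolding split V bim[symmetric] by (auto simp: P_def)
  moreover have "\<forall>i\<in>{0..m}. \<forall>j\<in>{0..m}. i \<noteq> j \<longrightarrow> P i \<inter> P j = {}"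
  proof (intro ballI impI)
    fix i j assume ij: "i \<in> {0..m}" "j \<in> {0..m}" "i \<noteq> j"
    show "P i \<inter> P j = {}"
    proof (cases "i = 0 \<or> j = 0")
      case True
      then show ?thesis using ij by (auto simp: P_def)
    next
      case False
      then have "i \<in> {1..m}" "j \<in> {1..m}" using ij by auto
      moreover then have "b i \<noteq> b j" using ij binj by (meson inj_on_eq_iff)
      ultimately show ?thesis using dis bE False by (simp add: P_def)
    qed
  qed
  moreover have "card (P 0) = 1" by (simp add: P_def)
  moreover have "\<forall>i\<in>{1..m}. card (P i) = k - 1"
    using bE E all by (auto simp: P_def card_Diff_singleton)
  moreover have "edges H = {P 0 \<union> P i | i. i \<in> {1..m}}"
  proof -
    have "P 0 \<union> P i = b i" if "i \<in> {1..m}" for i using that all bE by (auto simp: P_def)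
    then have "{P 0 \<union> P i | i. i \<in> {1..m}} = {b i | i. i \<in> {1..m}}" by blast
    then show ?thesis unfolding bim[symmetric] by blast
  qed
  ultimately show ?thesis using H unfolding is_hyperstar_def by blast
qed

section \<open>Brooms\<close>

text \<open>For \<open>k\<close>-uniform hypergraphs with \<open>b + 2\<close> edges, this describes \<open>S\<^sup>k(1, b)\<close> up to
  isomorphism: all edges except \<open>f\<close> contain the centre \<open>u\<close>, and \<open>f\<close> is attached to the vertex \<open>v\<close> of the edge \<open>g\<close>.\<close>

definition broom :: "'a set \<Rightarrow> 'a set set \<Rightarrow> 'a \<Rightarrow> 'a \<Rightarrow> 'a set \<Rightarrow> 'a set \<Rightarrow> bool" where
  "broom V E u v g f \<longleftrightarrow> V = \<Union>E \<and> g \<in> E \<and> f \<in> E \<and> u \<in> g \<and> v \<in> g \<and> u \<noteq> v \<and> u \<notin> f \<and>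
     (\<forall>e\<in>E - {f}. u \<in> e) \<and> (\<forall>e\<in>E - {f}. \<forall>e'\<in>E - {f}. e \<noteq> e' \<longrightarrow> e \<inter> e' = {u}) \<and>
     g \<inter> f = {v} \<and> (\<forall>e\<in>E - {f, g}. e \<inter> f = {})"

lemma broom_Int:
  "broom V E u v g f \<Longrightarrow> e \<in> E \<Longrightarrow> e' \<in> E \<Longrightarrow> e \<noteq> f \<Longrightarrow> e' \<noteq> f \<Longrightarrow> e \<noteq> e' \<Longrightarrow> e \<inter> e' = {u}"
  unfolding broom_def by simp

text \<open>Removing \<open>u\<close> and \<open>v\<close> from the edges of a broom leaves disjoint cores. Hence an isomorphism
  of brooms can be assembled from bijections between the cores.\<close>

lemma broom_ends:
  assumes "broom V E u v g f" "e \<in> E"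
  shows "e \<inter> {u, v} = (if e = g then {u, v} else if e = f then {v} else {u})"
proof -
  have 0: "g \<in> E" "f \<in> E" "u \<in> g" "v \<in> g" "u \<noteq> v" "u \<notin> f" "g \<inter> f = {v}"
    using assms(1) unfolding broom_def by auto
  have "v \<notin> e" "u \<in> e" if "e \<noteq> g" "e \<noteq> f"
  proof -
    have "g \<noteq> f" using 0 by blast
    then have "e \<inter> g = {u}" using broom_Int[OF assms(1), of e g] assms(2) that 0 by simp
    then show "v \<notin> e" "u \<in> e" using 0 by auto
  qed
  then show ?thesis using 0 by auto
qed

lemma broom_cores_disjoint:
  assumes "broom V E u v g f" "e \<in> E" "e' \<in> E" "e \<noteq> e'"
  shows "(e - {u, v}) \<inter> (e' - {u, v}) = {}"
proof -
  have *: "(e - {u, v}) \<inter> (f - {u, v}) = {}" if "e \<in> E" "e \<noteq> f" for e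
  proof (cases "e = g")
    case True
    have "g \<inter> f = {v}" using assms(1) by (simp add: broom_def)
    then show ?thesis using True by blast
  next
    case False
    then have "e \<inter> f = {}" using assms(1) that by (simp add: broom_def)
    then show ?thesis by blast
  qed
  have **: "(e - {u, v}) \<inter> (e' - {u, v}) = {}" if "e \<noteq> f" "e' \<noteq> f"
  proof -
    have "e \<inter> e' = {u}" using broom_Int[OF assms(1,2,3)] assms(4) that by simp
    then show ?thesis by blast
  qed
  consider "e = f" "e' \<noteq> f" | "e \<noteq> f" "e' = f" | "e \<noteq> f" "e' \<noteq> f" using assms(4) by blast
  then show ?thesis
  proof cases
    case 1 then show ?thesis using *[OF assms(3)] by blast
  next
    case 2 then show ?thesis using *[OF assms(2)] by simp
  next
    case 3 then show ?thesis by (rule **)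
  qed
qed

lemma broom_iso:
  assumes B1: "broom V1 E1 u1 v1 g1 f1" and B2: "broom V2 E2 u2 v2 g2 f2"
    and E1: "finite E1" "\<And>e. e \<in> E1 \<Longrightarrow> finite e \<and> card e = k"
    and E2: "finite E2" "\<And>e. e \<in> E2 \<Longrightarrow> finite e \<and> card e = k"
    and cE: "card E1 = card E2"
  shows "\<exists>F. bij_betw F V1 V2 \<and> E2 = (\<lambda>e. F ` e) ` E1"
proof -
  have b1: "g1 \<in> E1" "f1 \<in> E1" "g1 \<noteq> f1" "u1 \<noteq> v1" "V1 = \<Union>E1" "u1 \<in> V1" "v1 \<in> V1"
    using B1 unfolding broom_def by auto
  have b2: "g2 \<in> E2" "f2 \<in> E2" "g2 \<noteq> f2" "u2 \<noteq> v2" "V2 = \<Union>E2" "u2 \<in> V2" "v2 \<in> V2"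
    using B2 unfolding broom_def by auto
  have "card (E1 - {g1, f1}) = card (E2 - {g2, f2})"
    using b1 b2 E1 E2 cE by (simp add: card_Diff_subset)
  then obtain \<beta>0 where \<beta>0: "bij_betw \<beta>0 (E1 - {g1, f1}) (E2 - {g2, f2})"
    using finite_same_card_bij E1 E2 by (metis finite_Diff)
  define \<beta> where "\<beta> e = (if e = g1 then g2 else if e = f1 then f2 else \<beta>0 e)" for e
  have \<beta>: "bij_betw \<beta> E1 E2"
  proof -
    have "bij_betw \<beta> (E1 - {g1, f1}) (E2 - {g2, f2})"
      using \<beta>0 by (subst bij_betw_cong[where g = \<beta>0]) (auto simp: \<beta>_def)
    moreover have "bij_betw \<beta> {g1, f1} {g2, f2}"
      using b1 b2 by (auto simp: bij_betw_def inj_on_def \<beta>_def)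
    ultimately have "bij_betw \<beta> ((E1 - {g1, f1}) \<union> {g1, f1}) ((E2 - {g2, f2}) \<union> {g2, f2})"
      by (rule bij_betw_combine) auto
    moreover have "(E1 - {g1, f1}) \<union> {g1, f1} = E1" "(E2 - {g2, f2}) \<union> {g2, f2} = E2"
      using b1 b2 by auto
    ultimately show ?thesis by simp
  qed
  have \<beta>E: "\<beta> e \<in> E2" if "e \<in> E1" for e using \<beta> that by (auto simp: bij_betw_def)
  have \<beta>inj: "e = e'" if "\<beta> e = \<beta> e'" "e \<in> E1" "e' \<in> E1" for e e'
    using \<beta> that by (auto simp: bij_betw_def inj_on_def)
  have \<beta>g: "\<beta> e = g2 \<longleftrightarrow> e = g1" "\<beta> e = f2 \<longleftrightarrow> e = f1" if "e \<in> E1" for e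
  proof -
    have "\<beta> g1 = g2" "\<beta> f1 = f2" using b1(3) by (auto simp: \<beta>_def)
    then show "\<beta> e = g2 \<longleftrightarrow> e = g1" "\<beta> e = f2 \<longleftrightarrow> e = f1"
      using \<beta>inj[OF _ that b1(1)] \<beta>inj[OF _ that b1(2)] by auto
  qed
  let ?c1 = "\<lambda>e. e - {u1, v1}" and ?c2 = "\<lambda>e. e - {u2, v2}"
  have ends1: "e \<inter> {u1, v1} = (if e = g1 then {u1, v1} else if e = f1 then {v1} else {u1})" if "e \<in> E1" for e
    using broom_ends[OF B1 that] .
  have ends2: "\<beta> e \<inter> {u2, v2} = (if e = g1 then {u2, v2} else if e = f1 then {v2} else {u2})" if "e \<in> E1" for e
    using broom_ends[OF B2 \<beta>E[OF that]] \<beta>g[OF that] by simp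
  have "\<exists>h. bij_betw h (?c1 e) (?c2 (\<beta> e))" if e: "e \<in> E1" for e
  proof -
    have "card (e \<inter> {u1, v1}) = card (\<beta> e \<inter> {u2, v2})"
      unfolding ends1[OF e] ends2[OF e] using b1 b2 by simp
    moreover have "card (?c1 e) = card e - card (e \<inter> {u1, v1})"
      "card (?c2 (\<beta> e)) = card (\<beta> e) - card (\<beta> e \<inter> {u2, v2})"
      using E1(2)[OF e] E2(2)[OF \<beta>E[OF e]] by (simp_all add: card_Diff_subset_Int)
    ultimately have "card (?c1 e) = card (?c2 (\<beta> e))"
      using E1(2)[OF e] E2(2)[OF \<beta>E[OF e]] by simp
    then show ?thesis
      using E1(2)[OF e] E2(2)[OF \<beta>E[OF e]] by (intro finite_same_card_bij) auto
  qed
  then obtain h where h: "\<And>e. e \<in> E1 \<Longrightarrow> bij_betw (h e) (?c1 e) (?c2 (\<beta> e))" by metis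
  define F where "F x = (if x = u1 then u2 else if x = v1 then v2
      else h (THE e. e \<in> E1 \<and> x \<in> e) x)" for x
  have Fc: "F x = h e x" if "e \<in> E1" "x \<in> ?c1 e" for e x
  proof -
    have "(THE e. e \<in> E1 \<and> x \<in> e) = e"
    proof (rule the_equality)
      show "e \<in> E1 \<and> x \<in> e" using that by simp
      fix e' assume e': "e' \<in> E1 \<and> x \<in> e'"
      then have "x \<in> ?c1 e'" using that by auto
      then show "e' = e" using broom_cores_disjoint[OF B1, of e e'] e' that by blast
    qed
    then show ?thesis using that by (auto simp: F_def)
  qed
  have Fcore: "F ` ?c1 e = ?c2 (\<beta> e)" if e: "e \<in> E1" for e
  proof -
    have "F ` ?c1 e = h e ` ?c1 e" using Fc[OF e] by (rule image_cong[OF refl])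
    then show ?thesis using h[OF e] by (simp add: bij_betw_def)
  qed
  have Fu: "F u1 = u2" "F v1 = v2" using b1 by (auto simp: F_def)
  have Fe: "F ` e = \<beta> e" if e: "e \<in> E1" for e
  proof -
    have "F ` e = F ` (?c1 e) \<union> F ` (e \<inter> {u1, v1})" by blast
    also have "F ` (e \<inter> {u1, v1}) = \<beta> e \<inter> {u2, v2}"
      unfolding ends1[OF e] ends2[OF e] using Fu by simp
    finally show ?thesis unfolding Fcore[OF e] by blast
  qed
  have im: "(\<lambda>e. F ` e) ` E1 = E2"
    using Fe \<beta> by (simp add: bij_betw_def)
  have FV: "F ` V1 = V2" unfolding b1(5) b2(5) im[symmetric] by blast
  have out: "F x \<notin> {u2, v2}" if x: "x \<in> V1" "x \<notin> {u1, v1}" for x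
  proof -
    obtain e where "e \<in> E1" "x \<in> ?c1 e" using x b1(5) by auto
    then have "F x \<in> ?c2 (\<beta> e)" using Fcore by blast
    then show ?thesis by blast
  qed
  have "inj_on F V1"
  proof (rule inj_onI)
    fix x y assume xy: "x \<in> V1" "y \<in> V1" "F x = F y"
    show "x = y"
    proof (cases "x \<in> {u1, v1} \<or> y \<in> {u1, v1}")
      case True
      have iff: "F z \<in> {u2, v2} \<longleftrightarrow> z \<in> {u1, v1}" if "z \<in> V1" for z using out[OF that] Fu by blast
      have "x \<in> {u1, v1} \<and> y \<in> {u1, v1}"
        using True iff[OF xy(1)] iff[OF xy(2)] unfolding xy(3) by blast
      then show ?thesis using xy Fu b1 b2 by auto
    next
      case False
      obtain e e' where e: "e \<in> E1" "x \<in> ?c1 e" "e' \<in> E1" "y \<in> ?c1 e'" using False xy b1(5) by auto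
      have "F x \<in> ?c2 (\<beta> e)" using Fcore[OF e(1)] e(2) by blast
      moreover have "F x \<in> ?c2 (\<beta> e')" using Fcore[OF e(3)] e(4) unfolding xy(3) by blast
      ultimately have "\<beta> e = \<beta> e'"
        using broom_cores_disjoint[OF B2 \<beta>E[OF e(1)] \<beta>E[OF e(3)]] by blast
      then have "e = e'" by (rule \<beta>inj[OF _ e(1,3)])
      have "h e x = h e y"
        using Fc[OF e(1,2)] Fc[OF e(3,4)] xy(3) \<open>e = e'\<close> by simp
      moreover have "inj_on (h e) (?c1 e)" using h[OF e(1)] by (simp add: bij_betw_def)
      moreover have "y \<in> ?c1 e" using e(4) \<open>e = e'\<close> by simp
      ultimately show ?thesis using e(2) inj_onD by metis
    qed
  qed
  then show ?thesis using FV im by (auto simp: bij_betw_def)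
qed

text \<open>The edge of \<open>G\<^sup>k\<close> that extends the edge \<open>e\<close> of \<open>G\<close>.\<close>

definition power_edge :: "nat \<Rightarrow> 'a set \<Rightarrow> ('a + 'a set \<times> nat) set" where
  "power_edge k e = Inl ` e \<union> Inr ` ({e} \<times> {..<k - 2})"

lemma power_edge_Int: "e \<noteq> e' \<Longrightarrow> power_edge k e \<inter> power_edge k e' = Inl ` (e \<inter> e')"
  by (auto simp: power_edge_def)

lemma card_power_edge:
  assumes "k \<ge> 2" "finite e" "card e = 2"
  shows "finite (power_edge k e) \<and> card (power_edge k e) = k"
proof -
  have "card (power_edge k e) = card (Inl ` e :: ('a + 'a set \<times> nat) set)
      + card (Inr ` ({e} \<times> {..<k - 2}) :: ('a + 'a set \<times> nat) set)"
    unfolding power_edge_def using assms by (intro card_Un_disjoint) auto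
  also have "\<dots> = k" using assms by (simp add: card_image card_cartesian_product)
  finally show ?thesis using assms by (simp add: power_edge_def)
qed

lemma power_edge_inj: "inj (power_edge k)"
proof (rule injI)
  fix e e' :: "'a set" assume "power_edge k e = power_edge k e'"
  moreover have "e = {x. Inl x \<in> power_edge k e}" for e :: "'a set" by (auto simp: power_edge_def)
  ultimately show "e = e'" by metis
qed

lemma double_star_1_edges:
  "edges (double_star 1 b) = insert {0, 1} (insert {0, 2} ((\<lambda>i. {1, i}) ` {3..<b + 3}))"
proof -
  have "{2..<1 + 2::nat} = {2}" by auto
  moreover have "{1 + 2..<1 + b + 2} = {3..<b + 3}" by auto
  ultimately show ?thesis unfolding double_star_def by auto
qed

text \<open>The centre is the vertex 1 of \<open>S(1, b)\<close>, which carries the \<open>b\<close> pendent edges, and the edge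
  that avoids it is \<open>{0, 2}\<close>.\<close>

lemma double_star_power_1:
  fixes b :: nat
  assumes k: "k \<ge> 2"
  defines "S \<equiv> double_star_power k 1 b"
  shows "broom (verts S) (edges S) (Inl 1) (Inl 0) (power_edge k {0, 1}) (power_edge k {0, 2})"
    and "finite (edges S)" and "card (edges S) = b + 2"
    and "\<And>e. e \<in> edges S \<Longrightarrow> finite e \<and> card e = k"
proof -
  let ?D = "edges (double_star 1 b)"
  have ES: "edges S = power_edge k ` ?D"
    by (auto simp: S_def double_star_power_def power_hypergraph_def power_edge_def)
  have two: "finite e \<and> card e = 2" if "e \<in> ?D" for e
    using that unfolding double_star_1_edges by auto
  show "\<And>e. e \<in> edges S \<Longrightarrow> finite e \<and> card e = k"
    unfolding ES using two card_power_edge[OF k] by auto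
  show "finite (edges S)" unfolding ES double_star_1_edges by simp
  have "card ?D = b + 2"
  proof -
    have inj: "inj_on (\<lambda>i. {1, i}) {3..<b + 3::nat}" by (auto simp: inj_on_def doubleton_eq_iff)
    have "card ((\<lambda>i. {1, i}) ` {3..<b + 3::nat}) = b" by (rule trans[OF card_image[OF inj]]) simp
    moreover have "{0, 2} \<notin> (\<lambda>i. {1, i}) ` {3..<b + 3::nat}"
    proof
      assume "{0, 2} \<in> (\<lambda>i. {1, i}) ` {3..<b + 3::nat}"
      then have "1 \<in> {0, 2::nat}" by blast
      then show False by simp
    qed
    moreover have "{0, 1} \<notin> insert {0, 2} ((\<lambda>i. {1, i}) ` {3..<b + 3::nat})"
    proof
      assume "{0, 1} \<in> insert {0, 2} ((\<lambda>i. {1, i}) ` {3..<b + 3::nat})"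
      then show False
      proof (elim insertE imageE)
        assume 1: "{0, 1} = {0, 2::nat}"
        have "1 \<in> {0, 1::nat}" by simp
        then show False unfolding 1 by simp
      next
        fix i :: nat assume 2: "{0, 1} = {1, i}" "i \<in> {3..<b + 3}"
        have "0 \<in> {0, 1::nat}" by simp
        then show False unfolding 2(1) using 2(2) by simp
      qed
    qed
    ultimately show ?thesis unfolding double_star_1_edges by simp
  qed
  then show "card (edges S) = b + 2"
    unfolding ES using card_image[OF inj_on_subset[OF power_edge_inj subset_UNIV], of k ?D] by simp
  have VD: "verts (double_star 1 b) = \<Union>?D"
  proof -
    have "x \<in> \<Union>?D" if "x < b + 3" for x
    proof (cases "x < 3")
      case True
      then have "x \<in> {0, 1, 2}" by auto
      then show ?thesis unfolding double_star_1_edges by auto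
    next
      case False
      then have "{1, x} \<in> ?D" using that unfolding double_star_1_edges by auto
      then show ?thesis by blast
    qed
    moreover have "x < b + 3" if "x \<in> \<Union>?D" for x
      using that unfolding double_star_1_edges by (auto split: if_splits)
    moreover have "verts (double_star 1 b) = {..<b + 3}" by (auto simp: double_star_def)
    ultimately show ?thesis by auto
  qed
  have VS: "verts S = \<Union>(edges S)"
  proof -
    have "verts S = Inl ` (\<Union>?D) \<union> Inr ` (?D \<times> {..<k - 2})"
      unfolding S_def double_star_power_def power_hypergraph_def VD by simp
    also have "\<dots> = (\<Union>e\<in>?D. power_edge k e)" unfolding power_edge_def by blast
    finally show ?thesis unfolding ES .
  qed
  have mem: "Inl x \<in> power_edge k e \<longleftrightarrow> x \<in> e" for x :: nat and e
    by (auto simp: power_edge_def)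
  have i: "power_edge k e \<inter> power_edge k e' = Inl ` (e \<inter> e')" if "power_edge k e \<noteq> power_edge k e'" for e e' :: "nat set"
    using that by (intro power_edge_Int) auto
  have D1: "1 \<in> e" if "e \<in> ?D - {{0, 2}}" for e using that unfolding double_star_1_edges by auto
  have D2: "e \<inter> e' = {1}" if "e \<in> ?D - {{0, 2}}" "e' \<in> ?D - {{0, 2}}" "e \<noteq> e'" for e e'
    using that unfolding double_star_1_edges by auto
  have D3: "e \<inter> {0, 2} = {}" if "e \<in> ?D - {{0, 2}, {0, 1}}" for e
    using that unfolding double_star_1_edges by auto
  show "broom (verts S) (edges S) (Inl 1) (Inl 0) (power_edge k {0, 1}) (power_edge k {0, 2})"
    unfolding broom_def
  proof (intro conjI ballI impI)
    show "power_edge k {0, 1} \<in> edges S" "power_edge k {0, 2} \<in> edges S"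
      unfolding ES double_star_1_edges by auto
    fix E assume "E \<in> edges S - {power_edge k {0, 2}}"
    then obtain e where e: "E = power_edge k e" "e \<in> ?D - {{0, 2}}" unfolding ES by auto
    show "Inl 1 \<in> E" using D1[OF e(2)] e(1) mem by simp
    fix E' assume "E' \<in> edges S - {power_edge k {0, 2}}" and EE: "E \<noteq> E'"
    then obtain e' where e': "E' = power_edge k e'" "e' \<in> ?D - {{0, 2}}" unfolding ES by auto
    show "E \<inter> E' = {Inl 1}" using D2[OF e(2) e'(2)] i[of e e'] EE e e' by auto
  next
    fix E assume "E \<in> edges S - {power_edge k {0, 2}, power_edge k {0, 1}}"
    then obtain e where e: "E = power_edge k e" "e \<in> ?D - {{0, 2}, {0, 1}}" unfolding ES by auto
    show "E \<inter> power_edge k {0, 2} = {}"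
      using D3[OF e(2)] power_edge_Int[of e "{0, 2}" k] e by auto
  next
    have "{0, 1::nat} \<noteq> {0, 2}" by (auto simp: doubleton_eq_iff)
    then show "power_edge k {0, 1::nat} \<inter> power_edge k {0, 2} = {Inl 0}"
      using power_edge_Int[of "{0, 1::nat}" "{0, 2}" k] by auto
  qed (auto simp: VS mem)
qed

section \<open>Moving the edges to the root\<close>

text \<open>Every edge except \<open>f\<close> has its vertex nearest to the root \<open>u\<close> replaced by \<open>u\<close>.\<close>

definition move_edge :: "'a \<Rightarrow> ('a set \<Rightarrow> 'a) \<Rightarrow> 'a set \<Rightarrow> 'a set \<Rightarrow> 'a set" where
  "move_edge u p f e = (if e = f then f else insert u (e - {p e}))"

text \<open>As \<open>u \<notin> f\<close>, the vertex \<open>p f\<close> is not the root, so it lies in \<open>g - {p g}\<close> for a unique edge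
  \<open>g\<close>. After the move, \<open>f\<close> hangs at this vertex of the moved \<open>g\<close>.\<close>

lemma move_edges_broom:
  assumes R: "rooted V E u p" and f: "f \<in> E" "u \<notin> f" and ne: "\<And>e. e \<in> E \<Longrightarrow> e - {p e} \<noteq> {}"
    and EV: "\<And>e. e \<in> E \<Longrightarrow> e \<subseteq> V"
  obtains g where "g \<in> E" "g \<noteq> f" "inj_on (move_edge u p f) E"
    "broom V (move_edge u p f ` E) u (p f) (move_edge u p f g) f"
proof -
  let ?m = "move_edge u p f"
  have pe: "\<And>e. e \<in> E \<Longrightarrow> p e \<in> e" and un: "\<And>e. e \<in> E \<Longrightarrow> u \<notin> e - {p e}"
    and V: "V = insert u (\<Union>e\<in>E. e - {p e})"
    and dis: "\<And>e e'. e \<in> E \<Longrightarrow> e' \<in> E \<Longrightarrow> e \<noteq> e' \<Longrightarrow> (e - {p e}) \<inter> (e' - {p e'}) = {}"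
    using R unfolding rooted_def by auto
  have pf: "p f \<noteq> u" "p f \<in> V" using pe[OF f(1)] f EV by auto
  then obtain g where g: "g \<in> E" "p f \<in> g - {p g}" using V by blast
  have gf: "g \<noteq> f" using g by blast
  have me: "?m e = insert u (e - {p e})" if "e \<noteq> f" for e using that by (simp add: move_edge_def)
  have mf: "?m f = f" by (simp add: move_edge_def)
  have core: "?m e - {u} = e - {p e}" if "e \<in> E" "e \<noteq> f" for e using un[OF that(1)] me[OF that(2)] by auto
  have mfn: "?m e \<noteq> f" if "e \<noteq> f" for e using me[OF that] f(2) by auto
  have inj: "inj_on ?m E"
  proof (rule inj_onI)
    fix e e' assume e: "e \<in> E" "e' \<in> E" "?m e = ?m e'"
    show "e = e'"
    proof (rule ccontr)
      assume ne': "e \<noteq> e'"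
      then have "e \<noteq> f" "e' \<noteq> f" using e mfn mf by metis+
      then have "e - {p e} = e' - {p e'}" using core e by metis
      then show False using dis[OF e(1,2) ne'] ne[OF e(1)] by auto
    qed
  qed
  have int: "?m e \<inter> ?m e' = {u}" if "e \<in> E" "e' \<in> E" "e \<noteq> f" "e' \<noteq> f" "e \<noteq> e'" for e e'
    using dis[OF that(1,2,5)] me[OF that(3)] me[OF that(4)] by auto
  have fint: "?m e \<inter> f = (e - {p e}) \<inter> {p f}" if e: "e \<in> E" "e \<noteq> f" for e
    using dis[OF e(1) f(1) e(2)] f pe[OF f(1)] unfolding me[OF e(2)] by auto
  have mE: "E' = f \<or> (\<exists>e\<in>E. e \<noteq> f \<and> E' = ?m e)" if "E' \<in> ?m ` E" for E'
    using that mf by (cases "E' = f") auto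
  have "broom V (?m ` E) u (p f) (?m g) f"
    unfolding broom_def
  proof (intro conjI ballI impI)
    show "V = \<Union>(?m ` E)"
    proof
      have "x \<in> \<Union>(?m ` E)" if "x \<in> e - {p e}" "e \<in> E" for x e
        using that me[of e] mf by (cases "e = f") auto
      moreover have "u \<in> ?m g" using me[OF gf] by simp
      ultimately show "V \<subseteq> \<Union>(?m ` E)" unfolding V using g(1) by blast
      have "?m e \<subseteq> V" if "e \<in> E" for e
        using EV[OF that] me[of e] mf V by (cases "e = f") auto
      then show "\<Union>(?m ` E) \<subseteq> V" by blast
    qed
    show "?m g \<in> ?m ` E" "f \<in> ?m ` E" using g(1) f(1) mf by (auto intro: rev_image_eqI)
    show "u \<in> ?m g" "p f \<in> ?m g" using me[OF gf] g by auto
    show "u \<noteq> p f" "u \<notin> f" using pf f by auto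
    show "?m g \<inter> f = {p f}" using fint[OF g(1) gf] g(2) by blast
  next
    fix A assume "A \<in> ?m ` E - {f}"
    then obtain e where e: "e \<in> E" "e \<noteq> f" "A = ?m e" using mE by blast
    show "u \<in> A" using e me by simp
    fix B assume "B \<in> ?m ` E - {f}" "A \<noteq> B"
    then obtain e' where e': "e' \<in> E" "e' \<noteq> f" "B = ?m e'" using mE by blast
    show "A \<inter> B = {u}" using int e e' \<open>A \<noteq> B\<close> by blast
  next
    fix A assume A: "A \<in> ?m ` E - {f, ?m g}"
    then obtain e where e: "e \<in> E" "e \<noteq> f" "A = ?m e" using mE by blast
    have "e \<noteq> g" using A e(3) by auto
    from dis[OF e(1) g(1) this] have "p f \<notin> e - {p e}" using g(2) by blast
    then show "A \<inter> f = {}" unfolding e(3) fint[OF e(1,2)] by simp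
  qed
  then show ?thesis using that g(1) gf inj by blast
qed

section \<open>Comparison of the spectral radii\<close>

text \<open>\<open>A\<close> is the order-\<open>k\<close> tensor of \<open>H\<close> that is determined by \<open>g\<close>; entries at other index lists
  are irrelevant.\<close>

definition hweight_tensor :: "nat \<Rightarrow> (nat \<Rightarrow> real) \<Rightarrow> 'a hypergraph \<Rightarrow> 'a tensor \<Rightarrow> bool" where
  "hweight_tensor k g H A \<longleftrightarrow>
     (\<forall>js. length js = k \<longrightarrow> set js \<subseteq> verts H \<longrightarrow> A js = hweight g (edges H) (set js))"

text \<open>Moving an edge replaces the coordinate of \<open>x\<close> at \<open>p e\<close> by the largest coordinate, \<open>x u\<close>.\<close>

lemma move_edge_form_le:
  assumes R: "rooted V E u p" and e: "e \<in> E" "e \<subseteq> V" and g: "\<And>c. g c \<ge> 0"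
    and x: "\<And>i. i \<in> V \<Longrightarrow> 0 \<le> x i" "\<And>i. i \<in> V \<Longrightarrow> x i \<le> x u"
  shows "pform e (edge_weight g e) k x {}
    \<le> pform (move_edge u p f e) (edge_weight g (move_edge u p f e)) k x {}"
proof (cases "e = f \<or> p e = u")
  case True
  have "p e \<in> e" using R e by (simp add: rooted_def)
  then have "move_edge u p f e = e" using True by (auto simp: move_edge_def)
  then show ?thesis by simp
next
  case False
  have pe: "p e \<in> e" and u: "u \<notin> e" using R e False by (auto simp: rooted_def)
  define h where "h i = (if i = p e then u else i)" for i
  have inj: "inj_on h e" using u by (auto simp: inj_on_def h_def)
  have im: "h ` e = move_edge u p f e" using pe False by (auto simp: h_def move_edge_def)
  have bij: "bij_betw h e (move_edge u p f e)" using inj im by (simp add: bij_betw_def)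
  have "pform e (edge_weight g e) k x {} \<le> pform e (edge_weight g e) k (\<lambda>i. x (h i)) {}"
  proof (rule pform_mono)
    fix i assume "i \<in> e"
    then have "i \<in> V" using e by blast
    then show "0 \<le> x i" "x i \<le> x (h i)" using x by (auto simp: h_def)
  qed (rule edge_weight_nonneg[OF g])
  also have "\<dots> = pform (move_edge u p f e) (edge_weight g (move_edge u p f e)) k x {}"
    using pform_bij_betw[OF bij, of "edge_weight g (move_edge u p f e)" "edge_weight g e" "{}" k x]
      edge_weight_image[OF inj subset_refl] im by simp
  finally show ?thesis .
qed

text \<open>The maximum strictly increases unless nothing is moved. If \<open>r = r'\<close>, then \<open>x\<close> is also a
  maximiser after the move and satisfies both eigenvalue equations at \<open>u\<close>. Their left-hand sides
  agree then, although every edge moved to \<open>u\<close> adds a positive amount.\<close>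

lemma rayleigh_max_move_edges:
  assumes k: "k \<ge> 2" and V: "finite V" and E: "\<And>e. e \<in> E \<Longrightarrow> e \<subseteq> V \<and> card e = k"
    and g: "\<And>c. g c \<ge> 0" "g k > 0"
    and R: "rooted V E u p" and f: "f \<in> E" "u \<notin> f" and inj: "inj_on (move_edge u p f) E"
    and M: "rayleigh_max V k (hweight g E) r x"
    and x: "\<And>i. i \<in> V \<Longrightarrow> 0 < x i" "\<And>i. i \<in> V \<Longrightarrow> x i \<le> x u"
    and M': "rayleigh_max V k (hweight g (move_edge u p f ` E)) r' x'"
  shows "r \<le> r'" and "r = r' \<Longrightarrow> move_edge u p f ` E = E"
proof -
  let ?m = "move_edge u p f"
  have u: "u \<in> V" using R by (auto simp: rooted_def)
  have pe: "\<And>e. e \<in> E \<Longrightarrow> p e \<in> e" using R by (auto simp: rooted_def)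
  have fE: "finite E" using E V by (meson finite_Pow_iff finite_subset PowI subsetI)
  have mV: "?m e \<subseteq> V" if "e \<in> E" for e using E[OF that] u by (auto simp: move_edge_def)
  have fin: "finite e" if "e \<in> E" for e using E[OF that] V finite_subset by blast
  have xn: "\<And>i. i \<in> V \<Longrightarrow> 0 \<le> x i" using x(1) less_imp_le by blast
  have F: "pform V (hweight g E) m x a = (\<Sum>e\<in>E. pform e (edge_weight g e) m x a)" for m a
    using E by (intro pform_hweight[OF V]) auto
  have F': "pform V (hweight g (?m ` E)) m x a = (\<Sum>e\<in>E. pform (?m e) (edge_weight g (?m e)) m x a)" for m a
    using mV by (subst pform_hweight[OF V]) (auto simp: sum.reindex[OF inj])
  have le: "pform V (hweight g E) k x {} \<le> pform V (hweight g (?m ` E)) k x {}"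
    unfolding F F' using E xn x(2) by (intro sum_mono move_edge_form_le[OF R] g(1)) auto
  have N: "pnorm V k x > 0" using V xn x(1) u by (intro pnorm_pos) auto
  have b: "pform V (hweight g (?m ` E)) k x {} \<le> r' * pnorm V k x"
    using M' xn unfolding rayleigh_max_def by blast
  have eq: "pform V (hweight g E) k x {} = r * pnorm V k x"
    using M unfolding rayleigh_max_def by blast
  have "r * pnorm V k x \<le> r' * pnorm V k x" using le b eq by simp
  then show "r \<le> r'" using N by simp
  assume rr: "r = r'"
  have M2: "rayleigh_max V k (hweight g (?m ` E)) r x"
    using M M' le b eq rr unfolding rayleigh_max_def by auto
  note hn = hweight_nonneg[OF g(1)]
  have eqn: "pform V (hweight g (?m ` E)) (k - 1) x {u} = pform V (hweight g E) (k - 1) x {u}"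
    using rayleigh_max_eigen[OF V k hn M2 u] rayleigh_max_eigen[OF V k hn M u] by simp
  have fixed: "?m e = e" if "e \<in> E" "u \<in> e \<or> e = f" for e
    using rooted_parent_eq_root[OF R that(1)] that by (auto simp: move_edge_def)
  have all: "u \<in> e \<or> e = f" if e: "e \<in> E" for e
  proof (rule ccontr)
    assume no: "\<not> (u \<in> e \<or> e = f)"
    let ?t = "\<lambda>e. pform e (edge_weight g e) (k - 1) x {u}"
    have zero: "?t e' = 0" if "u \<notin> e'" for e'
      using that by (intro pform_edge_weight_eq_0) auto
    have ge: "?t e' \<le> ?t (?m e')" if e': "e' \<in> E" for e'
    proof (cases "u \<in> e' \<or> e' = f")
      case True
      then show ?thesis using fixed[OF e'] by simp
    next
      case False
      have "?t (?m e') \<ge> 0"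
        using mV[OF e'] xn by (intro pform_nonneg edge_weight_nonneg g(1)) auto
      then show ?thesis using zero[of e'] False by simp
    qed
    have "?t e < ?t (?m e)"
    proof -
      have me: "?m e = insert u (e - {p e})" using no by (simp add: move_edge_def)
      have d: "?m e - {u} = e - {p e}" unfolding me using no by auto
      have c: "card (?m e) = k" "card (?m e - {u}) = k - 1"
        unfolding d using me no pe[OF e] E[OF e] fin[OF e] k by (simp_all add: card_Diff_singleton)
      have "0 < g (card (?m e)) * prod x (?m e - {u})"
        using c g mV[OF e] x(1) by (intro mult_pos_pos prod_pos) auto
      also have "\<dots> \<le> ?t (?m e)"
        using c mV[OF e] xn fin[OF e] me by (intro pform_edge_ge_prod g(1)) auto
      finally show ?thesis using zero[of e] no by simp
    qed
    then have "(\<Sum>e\<in>E. ?t e) < (\<Sum>e\<in>E. ?t (?m e))"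
      using ge e by (intro sum_strict_mono_ex1[OF fE]) auto
    then show False using eqn unfolding F F' by simp
  qed
  show "?m ` E = E" using fixed all by (metis (no_types, lifting) image_cong image_ident)
qed

lemma spectral_radius_comparison:
  fixes T :: "'a hypergraph" and A :: "'a tensor"
  assumes k: "k \<ge> 2" and T: "uniform_hypergraph k T" "supertree T"
    and ns: "\<not> is_hyperstar (card (verts T)) k T"
    and g: "\<And>c. g c \<ge> 0" "g k > 0"
    and A: "hweight_tensor k g T A"
  defines "S \<equiv> double_star_power k 1 ((card (verts T) - 1) div (k - 1) + 1 - 3)"
  assumes B: "hweight_tensor k g S B"
  shows "spectral_radius k (verts T) A \<le> spectral_radius k (verts S) B \<and>
     (spectral_radius k (verts T) A = spectral_radius k (verts S) B \<longleftrightarrow> hypergraph_iso T S)"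
proof -
  define V E where "V = verts T" and "E = edges T"
  have V: "finite V" "V \<noteq> {}" and E: "\<And>e. e \<in> E \<Longrightarrow> e \<subseteq> V \<and> card e = k"
    using T(1) by (auto simp: uniform_hypergraph_def V_def E_def)
  have fE: "finite E" using E V by (meson finite_Pow_iff finite_subset PowI subsetI)
  have fin: "finite e \<and> card e = k" if "e \<in> E" for e using E[OF that] V finite_subset by blast
  have conn: "hconnected T" using T(2) by (simp add: supertree_def)
  note hn = hweight_nonneg[OF g(1)]
  obtain r x where M: "rayleigh_max V k (hweight g E) r x"
    using rayleigh_max_exists[OF V, of k] k by auto
  have xp: "x i > 0" if "i \<in> V" for i
  proof (rule rayleigh_max_pos[OF V(1) k g E _ M that])
    fix W assume W: "W \<subseteq> V" "W \<noteq> {}" "W \<noteq> V"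
    then obtain a b where "a \<in> W" "b \<in> V" "b \<notin> W" by blast
    then have "a \<in> verts T" "b \<in> verts T" using W(1) by (auto simp: V_def)
    from hconnected_crossing_edge[OF conn \<open>a \<in> W\<close> this \<open>b \<notin> W\<close>]
    obtain e where "e \<in> edges T" "e \<inter> W \<noteq> {}" "e - W \<noteq> {}" .
    then show "\<exists>e\<in>E. e \<inter> W \<noteq> {} \<and> e - W \<noteq> {}" unfolding E_def by blast
  qed
  \<comment> \<open>The root is a vertex where the maximiser is largest.\<close>
  have "Max (x ` V) \<in> x ` V" using V by (intro Max_in) auto
  then obtain u where u: "u \<in> V" "x u = Max (x ` V)" by auto
  have xu: "x i \<le> x u" if "i \<in> V" for i using u V that by simp
  obtain p where R: "rooted V E u p"
    using supertree_rooted[OF k T] u(1) unfolding V_def E_def by blast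
  have "\<exists>f\<in>E. u \<notin> f"
    using rooted_hyperstar[OF T(1)] R ns unfolding V_def E_def by blast
  then obtain f where f: "f \<in> E" "u \<notin> f" by blast
  have ne: "e - {p e} \<noteq> {}" if "e \<in> E" for e
  proof
    assume "e - {p e} = {}"
    then have "card e \<le> card {p e}" by (intro card_mono) auto
    then show False using fin[OF that] k by simp
  qed
  obtain h where h: "h \<in> E" "h \<noteq> f" and inj: "inj_on (move_edge u p f) E"
    and br: "broom V (move_edge u p f ` E) u (p f) (move_edge u p f h) f"
    using move_edges_broom[OF R f ne] E by blast
  let ?E = "move_edge u p f ` E"
  have pe: "\<And>e. e \<in> E \<Longrightarrow> p e \<in> e" and un: "\<And>e. e \<in> E \<Longrightarrow> u \<notin> e - {p e}"
    using R by (auto simp: rooted_def)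
  have fin': "finite e \<and> card e = k" if "e \<in> ?E" for e
  proof -
    obtain e0 where e0: "e0 \<in> E" "e = move_edge u p f e0" using \<open>e \<in> ?E\<close> by blast
    have "card (insert u (e0 - {p e0})) = k"
      using fin[OF e0(1)] pe[OF e0(1)] un[OF e0(1)] k by (simp add: card_insert_disjoint card_Diff_singleton)
    then show ?thesis using fin[OF e0(1)] e0 by (auto simp: move_edge_def)
  qed
  have EV': "\<And>e. e \<in> ?E \<Longrightarrow> e \<subseteq> V" 
  proof -
    have "V = \<Union>?E" using br by (simp add: broom_def)
    then show "\<And>e. e \<in> ?E \<Longrightarrow> e \<subseteq> V" by blast
  qed
  have cE: "card ?E = card E" using inj by (rule card_image)
  have cE2: "card E \<ge> 2"
  proof -
    have "card {f, h} \<le> card E" using f h fE by (intro card_mono) auto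
    then show ?thesis using h by simp
  qed
  have cV: "card V = 1 + card E * (k - 1)" using rooted_card[OF R fE fin] .
  have "(card V - 1) div (k - 1) = card E" using cV k by simp
  \<comment> \<open>With \<open>n' = card E + 1\<close>, the broom with as many edges as \<open>T\<close> has \<open>n' - 3 = card E - 2\<close>
    pendent edges at its centre.\<close>
  then have S: "S = double_star_power k 1 (card E - 2)"
    unfolding S_def V_def[symmetric] by (simp add: numeral_3_eq_3 numeral_2_eq_2)
  note SB = double_star_power_1[where b = "card E - 2", OF k, folded S]
  have cS: "card (edges S) = card E" using SB(3) cE2 by simp
  obtain F where F: "bij_betw F V (verts S)" "edges S = (\<lambda>e. F ` e) ` ?E"
    using broom_iso[OF br SB(1) _ fin' SB(2) SB(4)] fE cE cS by auto
  obtain r' x' where M': "rayleigh_max V k (hweight g ?E) r' x'"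
    using rayleigh_max_exists[OF V, of k] k by auto
  have MS: "rayleigh_max (verts S) k (hweight g (edges S)) r' (\<lambda>j. x' (inv_into V F j))"
    using rayleigh_max_iso[OF F(1) EV' F(2) M'] .
  have fVS: "finite (verts S)" using F(1) V(1) bij_betw_finite by blast
  have radS: "spectral_radius k (verts S) B = s" if "rayleigh_max (verts S) k (hweight g (edges S)) s y" for s y
    using spectral_radius_rayleigh_max[OF fVS k hn _ that] B unfolding hweight_tensor_def by blast
  have radT: "spectral_radius k (verts T) A = r"
    using spectral_radius_rayleigh_max[OF V(1) k hn _ M] A unfolding hweight_tensor_def V_def E_def by blast
  have mv: "r \<le> r'" "r = r' \<Longrightarrow> ?E = E"
    using rayleigh_max_move_edges[OF k V(1) E g R f inj M xp xu M'] by blast+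
  have iso1: "hypergraph_iso T S" if "r = r'"
  proof -
    have "bij_betw F (verts T) (verts S)" using F(1) by (simp only: V_def)
    moreover have "edges S = (\<lambda>e. F ` e) ` edges T" using F(2) mv(2)[OF that] by (simp only: E_def)
    ultimately show ?thesis unfolding hypergraph_iso_def by blast
  qed
  have iso2: "r = r'" if iso: "hypergraph_iso T S"
  proof -
    obtain G where G: "bij_betw G V (verts S)" "edges S = (\<lambda>e. G ` e) ` E"
      using iso unfolding hypergraph_iso_def V_def E_def by blast
    have EV: "\<And>e. e \<in> E \<Longrightarrow> e \<subseteq> V" using E by blast
    from radS[OF rayleigh_max_iso[OF G(1) EV G(2) M]] radS[OF MS] show ?thesis by simp
  qed
  show ?thesis unfolding radT radS[OF MS] using mv(1) iso1 iso2 by blast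
qed

section \<open>Adjacency, signless Laplacian and incidence tensors\<close>

lemma adjacency_hweight_tensor:
  assumes "\<And>e. e \<in> edges H \<Longrightarrow> finite e \<and> card e = k" "finite (edges H)"
  shows "hweight_tensor k (\<lambda>c. if c = k then 1 / fact (k - 1) else 0) H (adjacency_tensor k H)"
  unfolding hweight_tensor_def
proof (intro allI impI)
  fix js :: "'a list"
  have "edge_weight (\<lambda>c. if c = k then 1 / fact (k - 1) else 0) e (set js)
      = (if e = set js then 1 / fact (k - 1) else 0)" if "e \<in> edges H" for e
    using assms(1)[OF that] by (auto simp: edge_weight_def dest: card_subset_eq)
  then have "hweight (\<lambda>c. if c = k then 1 / fact (k - 1) else 0) (edges H) (set js)
      = (\<Sum>e\<in>edges H. if e = set js then 1 / fact (k - 1) else 0)"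
    unfolding hweight_def by (rule sum.cong[OF refl])
  also have "\<dots> = adjacency_tensor k H js"
    using assms(2) by (simp add: adjacency_tensor_def)
  finally show "adjacency_tensor k H js = hweight (\<lambda>c. if c = k then 1 / fact (k - 1) else 0) (edges H) (set js)"
    by simp
qed

lemma replicate_hd_iff_card_set:
  assumes "js \<noteq> []"
  shows "js = replicate (length js) (hd js) \<longleftrightarrow> card (set js) = 1"
proof
  assume "js = replicate (length js) (hd js)"
  then have "set js = {hd js}" using assms by (metis length_0_conv set_replicate)
  then show "card (set js) = 1" by simp
next
  assume "card (set js) = 1"
  then obtain a where a: "set js = {a}" by (auto simp: card_1_singleton_iff)
  then have "hd js = a" using assms hd_in_set by blast
  then show "js = replicate (length js) (hd js)" using a by (intro replicate_eqI) auto
qed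

lemma signless_laplacian_hweight_tensor:
  assumes k: "k \<ge> 2" and "\<And>e. e \<in> edges H \<Longrightarrow> finite e \<and> card e = k" "finite (edges H)"
  shows "hweight_tensor k (\<lambda>c. (if c = k then 1 / fact (k - 1) else 0) + (if c = 1 then 1 else 0)) H
    (signless_laplacian_tensor k H)"
  unfolding hweight_tensor_def
proof (intro allI impI)
  fix js :: "'a list" assume js: "length js = k" "set js \<subseteq> verts H"
  have ne: "js \<noteq> []" using js k by auto
  let ?a = "\<lambda>c. if c = k then 1 / fact (k - 1) else (0::real)" and ?d = "\<lambda>c::nat. if c = 1 then 1 else (0::real)"
  have "hweight (\<lambda>c. ?a c + ?d c) (edges H) (set js) = hweight ?a (edges H) (set js) + hweight ?d (edges H) (set js)"
    unfolding hweight_def sum.distrib[symmetric] by (rule sum.cong) (simp_all add: edge_weight_def)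
  also have "hweight ?a (edges H) (set js) = adjacency_tensor k H js"
    using adjacency_hweight_tensor[OF assms(2,3)] js unfolding hweight_tensor_def by simp
  also have "hweight ?d (edges H) (set js) = degree_tensor k H js"
  proof (cases "card (set js) = 1")
    case True
    then have "set js = {hd js}" using ne by (metis card_1_singletonE hd_in_set singletonD list.set_sel(1))
    then have "hweight ?d (edges H) (set js) = (\<Sum>e\<in>edges H. if hd js \<in> e then 1 else 0)"
      unfolding hweight_def edge_weight_def by (intro sum.cong) auto
    also have "\<dots> = real (degree H (hd js))"
      using assms(3) by (simp add: degree_def sum.inter_filter[symmetric])
    finally show ?thesis
      using replicate_hd_iff_card_set[OF ne] True js by (simp add: degree_tensor_def)
  next
    case False
    then show ?thesis
      using replicate_hd_iff_card_set[OF ne] js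
      by (simp add: degree_tensor_def hweight_def edge_weight_def)
  qed
  finally show "signless_laplacian_tensor k H js = hweight (\<lambda>c. ?a c + ?d c) (edges H) (set js)"
    by (simp add: signless_laplacian_tensor_def)
qed

lemma incidence_Q_hweight_tensor:
  assumes "finite (edges H)"
  shows "hweight_tensor k (\<lambda>c. 1) H (incidence_Q_tensor H)"
  using assms
  by (simp add: hweight_tensor_def hweight_def edge_weight_def incidence_Q_tensor_def sum.inter_filter[symmetric])

theorem theorem21:
  fixes T :: "'a hypergraph" and k n n' :: nat
  assumes "k \<ge> 3"
    and "uniform_hypergraph k T"
    and "supertree T"
    and "card (verts T) = n"
    and "n' = (n - 1) div (k - 1) + 1"
    and "\<not> is_hyperstar n k T"
  shows
    "spectral_radius k (verts T) (adjacency_tensor k T)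
       \<le> spectral_radius k (verts (double_star_power k 1 (n' - 3)))
           (adjacency_tensor k (double_star_power k 1 (n' - 3))) \<and>
     spectral_radius k (verts T) (signless_laplacian_tensor k T)
       \<le> spectral_radius k (verts (double_star_power k 1 (n' - 3)))
           (signless_laplacian_tensor k (double_star_power k 1 (n' - 3))) \<and>
     spectral_radius k (verts T) (incidence_Q_tensor T)
       \<le> spectral_radius k (verts (double_star_power k 1 (n' - 3)))
           (incidence_Q_tensor (double_star_power k 1 (n' - 3))) \<and>
     (spectral_radius k (verts T) (adjacency_tensor k T)
        = spectral_radius k (verts (double_star_power k 1 (n' - 3)))
            (adjacency_tensor k (double_star_power k 1 (n' - 3)))
      \<longleftrightarrow> hypergraph_iso T (double_star_power k 1 (n' - 3))) \<and>
     (spectral_radius k (verts T) (signless_laplacian_tensor k T)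
        = spectral_radius k (verts (double_star_power k 1 (n' - 3)))
            (signless_laplacian_tensor k (double_star_power k 1 (n' - 3)))
      \<longleftrightarrow> hypergraph_iso T (double_star_power k 1 (n' - 3))) \<and>
     (spectral_radius k (verts T) (incidence_Q_tensor T)
        = spectral_radius k (verts (double_star_power k 1 (n' - 3)))
            (incidence_Q_tensor (double_star_power k 1 (n' - 3)))
      \<longleftrightarrow> hypergraph_iso T (double_star_power k 1 (n' - 3)))"
proof -
  define S where "S = double_star_power k 1 (n' - 3)"
  have k: "k \<ge> 2" using assms(1) by simp
  have S: "S = double_star_power k 1 ((card (verts T) - 1) div (k - 1) + 1 - 3)"
    using assms(4,5) by (simp add: S_def)
  have ns: "\<not> is_hyperstar (card (verts T)) k T" using assms(4,6) by simp
  have fV: "finite (verts T)" and E: "\<And>e. e \<in> edges T \<Longrightarrow> e \<subseteq> verts T \<and> card e = k"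
    using assms(2) by (auto simp: uniform_hypergraph_def)
  have fT: "finite (edges T)" using E fV by (meson finite_Pow_iff finite_subset PowI subsetI)
  have ET: "\<And>e. e \<in> edges T \<Longrightarrow> finite e \<and> card e = k" using E fV finite_subset by blast
  note SB = double_star_power_1[where b = "n' - 3", OF k, folded S_def]
  note cmp = spectral_radius_comparison[OF k assms(2,3) ns, folded S]
  show ?thesis
    unfolding S_def[symmetric]
    using cmp[OF _ _ adjacency_hweight_tensor[OF ET fT] adjacency_hweight_tensor[OF SB(4) SB(2)]]
      cmp[OF _ _ signless_laplacian_hweight_tensor[OF k ET fT]
        signless_laplacian_hweight_tensor[OF k SB(4) SB(2)]]
      cmp[OF _ _ incidence_Q_hweight_tensor[OF fT] incidence_Q_hweight_tensor[OF SB(2)]]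
    by auto
qed

end
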